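(* Let $G$ be a non-archimedean Hausdorff topological group. The following statements are equivalent: (1) $G$ is amenable. (2) For every $\epsilon > 0$, every open subgroup $H \leq G$, every map $\varphi \colon H\backslash G \to \{0,\ldots,n\}$ with $n \geq 1$, and every finite subset $E \subseteq G$, there is a finite non-empty subset $F \subseteq G$ with $$\forall i \in \{0,\ldots,n\}\ \forall g \in E \colon\quad \bigl|\, |F \cap (\varphi \circ \pi_{H})^{-1}(i)| - |gF \cap (\varphi \circ \pi_{H})^{-1}(i)| \,\bigr| \leq \epsilon |F| .$$ (3) For every $\epsilon > 0$, every open subgroup $H \leq G$, every subset $A \subseteq G$, and every finite subset $E \subseteq G$, there is a finite non-empty subset $F \subseteq G$ such that $$\forall g \in E \colon\quad \bigl|\, |F \cap HA| - |gF \cap HA| \,\bigr| \leq \epsilon |F| .$$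
   Context: A topological group is non-archimedean if every neighborhood of the neutral element contains an open subgroup. For $H\le G$, $H\backslash G=\{Hx: x\in G\}$ and $\pi_H\colon G\to H\backslash G$, $x\mapsto Hx$. Amenability: a function $f\colon G\to\mathbb{R}$ is uniformly continuous for the right uniformity ($G_r$) if for every $\epsilon>0$ there is an identity neighborhood $U$ with $|f(x)-f(y)|\le\epsilon$ whenever $xy^{-1}\in U$; ${\rm UC}_b(G_r)$ is the space of bounded such functions. A mean on $G_r$ is a linear map $\nu\colon {\rm UC}_b(G_r)\to\mathbb{R}$ with $\inf_{x\in G} f(x)\le\nu(f)\le\sup_{x\in G} f(x)$ for all $f$. The topological group $G$ is amenable if there is a mean $\nu$ on $G_r$ with $\nu(f\circ\lambda_G(g))=\nu(f)$ for all $f\in{\rm UC}_b(G_r)$ and $g\in G$, where $\lambda_G(g)(x)=gx$. *)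

theory Defs
  imports "HOL-Analysis.Analysis" "HOL-Algebra.Coset"
begin

locale topological_group = group G for G (structure) +
  fixes T :: "'a topology"
  assumes topspace_eq_carrier: "topspace T = carrier G"
    and continuous_mult:
      "continuous_map (prod_topology T T) T (\<lambda>(x, y). x \<otimes> y)"
    and continuous_inv: "continuous_map T T (\<lambda>x. inv x)"

text \<open>Neighborhoods are not required to be open.\<close>

definition one_nbhd :: "('a, 'b) monoid_scheme \<Rightarrow> 'a topology \<Rightarrow> 'a set \<Rightarrow> bool" where
  "one_nbhd G T U \<longleftrightarrow>
     U \<subseteq> topspace T \<and> (\<exists>V. openin T V \<and> \<one>\<^bsub>G\<^esub> \<in> V \<and> V \<subseteq> U)"

definition open_subgroup :: "('a, 'b) monoid_scheme \<Rightarrow> 'a topology \<Rightarrow> 'a set \<Rightarrow> bool" where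
  "open_subgroup G T H \<longleftrightarrow> subgroup H G \<and> openin T H"

definition non_archimedean :: "('a, 'b) monoid_scheme \<Rightarrow> 'a topology \<Rightarrow> bool" where
  "non_archimedean G T \<longleftrightarrow>
     (\<forall>U. one_nbhd G T U \<longrightarrow> (\<exists>H. open_subgroup G T H \<and> H \<subseteq> U))"

definition coset_proj :: "('a, 'b) monoid_scheme \<Rightarrow> 'a set \<Rightarrow> 'a \<Rightarrow> 'a set" where
  "coset_proj G H x = H #>\<^bsub>G\<^esub> x"

definition right_uniformly_continuous ::
  "('a, 'b) monoid_scheme \<Rightarrow> 'a topology \<Rightarrow> ('a \<Rightarrow> real) \<Rightarrow> bool" where
  "right_uniformly_continuous G T f \<longleftrightarrow>
     (\<forall>\<epsilon>>0. \<exists>U. one_nbhd G T U \<and>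
        (\<forall>x\<in>carrier G. \<forall>y\<in>carrier G. x \<otimes>\<^bsub>G\<^esub> inv\<^bsub>G\<^esub> y \<in> U \<longrightarrow> \<bar>f x - f y\<bar> \<le> \<epsilon>))"

text \<open>Functions from the group to the reals are represented by extensional functions, so
  that two of them are equal iff they agree on the carrier. The vector space operations and
  the composition with left translations are restricted to the carrier accordingly.\<close>

definition UC_b :: "('a, 'b) monoid_scheme \<Rightarrow> 'a topology \<Rightarrow> ('a \<Rightarrow> real) set" where
  "UC_b G T = {f \<in> extensional (carrier G).
     right_uniformly_continuous G T f \<and> bounded (f ` carrier G)}"

definition mean ::
  "('a, 'b) monoid_scheme \<Rightarrow> 'a topology \<Rightarrow> (('a \<Rightarrow> real) \<Rightarrow> real) \<Rightarrow> bool" where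
  "mean G T \<nu> \<longleftrightarrow>
     (\<forall>f\<in>UC_b G T. \<forall>h\<in>UC_b G T. \<nu> (\<lambda>x\<in>carrier G. f x + h x) = \<nu> f + \<nu> h) \<and>
     (\<forall>c::real. \<forall>f\<in>UC_b G T. \<nu> (\<lambda>x\<in>carrier G. c * f x) = c * \<nu> f) \<and>
     (\<forall>f\<in>UC_b G T. (INF x\<in>carrier G. f x) \<le> \<nu> f \<and> \<nu> f \<le> (SUP x\<in>carrier G. f x))"

definition left_transl :: "('a, 'b) monoid_scheme \<Rightarrow> 'a \<Rightarrow> 'a \<Rightarrow> 'a" where
  "left_transl G g x = g \<otimes>\<^bsub>G\<^esub> x"

definition amenable :: "('a, 'b) monoid_scheme \<Rightarrow> 'a topology \<Rightarrow> bool" where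
  "amenable G T \<longleftrightarrow>
     (\<exists>\<nu>. mean G T \<nu> \<and>
        (\<forall>f\<in>UC_b G T. \<forall>g\<in>carrier G.
           \<nu> (restrict (f \<circ> left_transl G g) (carrier G)) = \<nu> f))"

end

theory Submission
  imports Defs
begin

text \<open>
  The easy implications are these. From an invariant mean one obtains Folner sets for a colouring of
  \<open>H \ G\<close> by sampling: refine the colouring by its translates under \<open>E\<close>, and choose points of every
  refined colour in proportion to the mass that the mean gives to it
  (\<open>amenable_imp_folner_on_colourings\<close>). The sampled points can be chosen distinct, because in an
  infinite group an invariant mean gives no mass to finite sets. A set \<open>HA\<close> is a colour class of a
  colouring with two colours.

  The substance is that Folner sets for one set \<open>HA\<close> at a time suffice for amenability. Fix \<open>H\<close> and a
  finitely supported signed measure \<open>m\<close> on \<open>G\<close> of total mass \<open>0\<close>, for example \<open>\<delta>\<^sub>g - \<delta>\<^sub>1\<close>, and let \<open>b\<close> bound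
  its integrals over the \<open>H\<close>-invariant functions from \<open>G\<close> to the unit interval. Then some convolution
  \<open>m w\<close> with a probability measure \<open>w\<close> admits the bound \<open>3/4 \<cdot> b\<close> (\<open>contraction_step\<close>). Otherwise a
  minimax argument gives one invariant function all of whose right translates have large
  \<open>m\<close>-integral. The gap is so large that it persists when the function is replaced by the indicator of
  the set where it is at least \<open>1/2\<close>, and then the Folner condition fails for this single set. The loss
  in rounding is harmless because each step has to gain only a fixed factor, and iteration makes the bound arbitrarily small (\<open>reiter_on_invariant_functions\<close>).

  Right convolution preserves what has been achieved for other elements \<open>g\<close> and other functions, so
  finitely many conditions can be met one after the other (\<open>almost_invariant_probability\<close>). In a
  non-archimedean group every bounded right uniformly continuous function is uniformly close to functions
  invariant under open subgroups. Hence no combination of the functions \<open>f \<circ> \<lambda>\<^sub>g - f\<close> is bounded above by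
  a negative constant, and the Hahn-Banach theorem yields the invariant mean
  (\<open>folner_imp_amenable\<close>).
\<close>

section \<open>Sublinear and linear functionals on spaces of functions\<close>

text \<open>Scalars enter through an inequality for \<open>c > 0\<close> only, so that the condition survives infima;
  equality for \<open>c \<ge> 0\<close> follows, see \<open>sublinear_onD\<close>.\<close>

definition sublinear_on :: "('x \<Rightarrow> real) set \<Rightarrow> (('x \<Rightarrow> real) \<Rightarrow> real) \<Rightarrow> bool" where
  "sublinear_on S q \<longleftrightarrow>
     (\<forall>f\<in>S. \<forall>h\<in>S. q (\<lambda>x. f x + h x) \<le> q f + q h) \<and>
     (\<forall>f\<in>S. \<forall>c>0. q (\<lambda>x. c * f x) \<le> c * q f)"

definition linear_on_space :: "('x \<Rightarrow> real) set \<Rightarrow> (('x \<Rightarrow> real) \<Rightarrow> real) \<Rightarrow> bool" where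
  "linear_on_space S L \<longleftrightarrow>
     (\<forall>f\<in>S. \<forall>h\<in>S. L (\<lambda>x. f x + h x) = L f + L h) \<and>
     (\<forall>f\<in>S. \<forall>c. L (\<lambda>x. c * f x) = c * L f)"

definition function_space :: "('x \<Rightarrow> real) set \<Rightarrow> bool" where
  "function_space S \<longleftrightarrow> S \<noteq> {} \<and> (\<forall>f\<in>S. \<forall>h\<in>S. (\<lambda>x. f x + h x) \<in> S) \<and>
     (\<forall>f\<in>S. \<forall>c. (\<lambda>x. c * f x) \<in> S)"

lemma sublinear_on_add:
  "sublinear_on S q \<Longrightarrow> f \<in> S \<Longrightarrow> h \<in> S \<Longrightarrow> q (\<lambda>x. f x + h x) \<le> q f + q h"
  by (simp add: sublinear_on_def)

lemma sublinear_on_scale: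
  "sublinear_on S q \<Longrightarrow> f \<in> S \<Longrightarrow> c > 0 \<Longrightarrow> q (\<lambda>x. c * f x) \<le> c * q f"
  by (simp add: sublinear_on_def)

lemma function_space_add:
  "function_space S \<Longrightarrow> f \<in> S \<Longrightarrow> h \<in> S \<Longrightarrow> (\<lambda>x. f x + h x) \<in> S"
  by (simp add: function_space_def)

lemma function_space_scale:
  "function_space S \<Longrightarrow> f \<in> S \<Longrightarrow> (\<lambda>x. c * f x) \<in> S"
  by (simp add: function_space_def)

text \<open>All sublinear functionals below are infima of families which are sublinear only up to a
  change of the index: chains of sublinear functionals, the shifts \<open>f \<mapsto> q (f + t h) - t q h\<close>, and
  suprema over a set after adding an element of a cone.\<close>

lemma sublinear_on_INF:
  fixes \<phi> :: "'i \<Rightarrow> ('x \<Rightarrow> real) \<Rightarrow> real"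
  assumes S: "function_space S" and I: "I \<noteq> {}"
    and bdd: "\<And>f. f \<in> S \<Longrightarrow> bdd_below ((\<lambda>i. \<phi> i f) ` I)"
    and add: "\<And>f h i j. f \<in> S \<Longrightarrow> h \<in> S \<Longrightarrow> i \<in> I \<Longrightarrow> j \<in> I \<Longrightarrow>
        \<exists>k\<in>I. \<phi> k (\<lambda>x. f x + h x) \<le> \<phi> i f + \<phi> j h"
    and scale: "\<And>f c i. f \<in> S \<Longrightarrow> c > 0 \<Longrightarrow> i \<in> I \<Longrightarrow>
        \<exists>k\<in>I. \<phi> k (\<lambda>x. c * f x) \<le> c * \<phi> i f"
  shows "sublinear_on S (\<lambda>f. INF i\<in>I. \<phi> i f)"
  unfolding sublinear_on_def
proof (intro conjI ballI allI impI)
  fix f h assume f: "f \<in> S" and h: "h \<in> S"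
  have fh: "(\<lambda>x. f x + h x) \<in> S"
    using S f h by (auto simp: function_space_def)
  let ?q = "\<lambda>f. INF i\<in>I. \<phi> i f"
  have *: "?q (\<lambda>x. f x + h x) \<le> \<phi> i f + \<phi> j h" if "i \<in> I" "j \<in> I" for i j
    using add[OF f h that] cINF_lower2[OF bdd[OF fh]] by blast
  have "?q (\<lambda>x. f x + h x) - \<phi> j h \<le> ?q f" if "j \<in> I" for j
    using *[OF _ that] by (intro cINF_greatest I) (simp add: algebra_simps)
  then have "?q (\<lambda>x. f x + h x) - ?q f \<le> ?q h"
    by (intro cINF_greatest I) (force simp: algebra_simps)
  then show "?q (\<lambda>x. f x + h x) \<le> ?q f + ?q h" by simp
next
  fix f and c :: real assume f: "f \<in> S" and c: "c > 0"
  have cf: "(\<lambda>x. c * f x) \<in> S"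
    using S f by (auto simp: function_space_def)
  let ?q = "\<lambda>f. INF i\<in>I. \<phi> i f"
  have "?q (\<lambda>x. c * f x) \<le> c * \<phi> i f" if "i \<in> I" for i
    using scale[OF f c that] cINF_lower2[OF bdd[OF cf]] by blast
  then have "?q (\<lambda>x. c * f x) / c \<le> ?q f"
    using c by (intro cINF_greatest I) (simp add: field_simps)
  then show "?q (\<lambda>x. c * f x) \<le> c * ?q f"
    using c by (simp add: field_simps)
qed

lemma sublinear_onD:
  assumes S: "function_space S" and q: "sublinear_on S q"
  shows "q (\<lambda>x. 0) = 0"
    and "\<And>f. f \<in> S \<Longrightarrow> - q (\<lambda>x. - f x) \<le> q f"
    and "\<And>f c. f \<in> S \<Longrightarrow> c \<ge> 0 \<Longrightarrow> q (\<lambda>x. c * f x) = c * q f"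
proof -
  obtain f0 where "f0 \<in> S" using S by (auto simp: function_space_def)
  then have "(\<lambda>x. 0 * f0 x) \<in> S" using S unfolding function_space_def by blast
  then have 0: "(\<lambda>x. 0) \<in> S" by simp
  have "q (\<lambda>x. c * 0) \<le> c * q (\<lambda>x. 0)" if "c > 0" for c
    using sublinear_on_scale[OF q 0 that] .
  from this[of 2] this[of "1/2"] show q0: "q (\<lambda>x. 0) = 0" by simp
  show "- q (\<lambda>x. - f x) \<le> q f" if f: "f \<in> S" for f
  proof -
    have "(\<lambda>x. -1 * f x) \<in> S" using function_space_scale[OF S f] .
    from sublinear_on_add[OF q f this]
    have "q (\<lambda>x. f x + (-1 * f x)) \<le> q f + q (\<lambda>x. -1 * f x)" .
    then show ?thesis using q0 by simp
  qed
  show "q (\<lambda>x. c * f x) = c * q f" if f: "f \<in> S" and c: "c \<ge> 0" for f c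
  proof (cases "c = 0")
    case False
    then have c: "c > 0" using c by simp
    have "(\<lambda>x. c * f x) \<in> S" using function_space_scale[OF S f] .
    from sublinear_on_scale[OF q this, of "inverse c"]
    have "q (\<lambda>x. inverse c * (c * f x)) \<le> inverse c * q (\<lambda>x. c * f x)"
      using c by simp
    then have "q f \<le> inverse c * q (\<lambda>x. c * f x)" 
      using c by (simp add: mult.assoc[symmetric])
    then have "c * q f \<le> q (\<lambda>x. c * f x)"
      using c by (simp add: field_simps)
    moreover have "q (\<lambda>x. c * f x) \<le> c * q f"
      using sublinear_on_scale[OF q f c] .
    ultimately show ?thesis by simp
  qed (use q0 in simp)
qed

text \<open>The infimum over \<open>t \<ge> 0\<close> of \<open>q (f + t h) - t q h\<close> is sublinear and below \<open>q\<close>, hence equal to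
  \<open>q\<close> by minimality. The term for \<open>t = 1\<close> then yields the missing inequality
  \<open>q f + q h \<le> q (f + h)\<close>.\<close>

lemma minimal_sublinear_imp_linear:
  assumes S: "function_space S" and q: "sublinear_on S q"
    and min: "\<And>r f. sublinear_on S r \<Longrightarrow> (\<forall>f\<in>S. r f \<le> q f) \<Longrightarrow> f \<in> S \<Longrightarrow> r f = q f"
  shows "linear_on_space S q"
proof -
  have addS: "(\<lambda>x. f x + h x) \<in> S" if "f \<in> S" "h \<in> S" for f h
    by (rule function_space_add[OF S that])
  have scaleS: "(\<lambda>x. c * f x) \<in> S" if "f \<in> S" for f c
    by (rule function_space_scale[OF S that])
  have sub: "q (\<lambda>x. f x + h x) \<le> q f + q h" if "f \<in> S" "h \<in> S" for f h
    by (rule sublinear_on_add[OF q that])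
  note hom = sublinear_onD(3)[OF S q]
  have add: "q (\<lambda>x. f x + h x) = q f + q h" if f: "f \<in> S" and h: "h \<in> S" for f h
  proof -
    define r where "r = (\<lambda>f. INF t\<in>{0..}. q (\<lambda>x. f x + t * h x) - t * q h)"
    have bdd: "bdd_below ((\<lambda>t. q (\<lambda>x. k x + t * h x) - t * q h) ` {0..})" if k: "k \<in> S" for k
    proof (rule bdd_belowI2)
      fix t :: real assume t: "t \<in> {0..}"
      have mk: "(\<lambda>x. - 1 * k x) \<in> S" using scaleS[OF k] .
      have "q (\<lambda>x. (k x + t * h x) + (- 1 * k x)) \<le> q (\<lambda>x. k x + t * h x) + q (\<lambda>x. - 1 * k x)"
        by (intro sub addS scaleS k h)
      moreover have "(\<lambda>x. (k x + t * h x) + (- 1 * k x)) = (\<lambda>x. t * h x)" by auto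
      ultimately show "- q (\<lambda>x. - 1 * k x) \<le> q (\<lambda>x. k x + t * h x) - t * q h"
        using hom[OF h, of t] t by simp
    qed
    have r: "sublinear_on S r"
      unfolding r_def
    proof (rule sublinear_on_INF[OF S])
      fix f1 f2 and s t :: real
      assume *: "f1 \<in> S" "f2 \<in> S" "s \<in> {0..}" "t \<in> {0..}"
      have "q (\<lambda>x. (f1 x + s * h x) + (f2 x + t * h x))
              \<le> q (\<lambda>x. f1 x + s * h x) + q (\<lambda>x. f2 x + t * h x)"
        by (intro sub addS scaleS * h)
      moreover have "(\<lambda>x. (f1 x + s * h x) + (f2 x + t * h x))
          = (\<lambda>x. f1 x + f2 x + (s + t) * h x)"
        by (auto simp: algebra_simps)
      ultimately show "\<exists>u\<in>{0..}. q (\<lambda>x. f1 x + f2 x + u * h x) - u * q h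
          \<le> q (\<lambda>x. f1 x + s * h x) - s * q h + (q (\<lambda>x. f2 x + t * h x) - t * q h)"
        using * by (intro bexI[of _ "s + t"]) (auto simp: algebra_simps)
    next
      fix f1 and c s :: real
      assume *: "f1 \<in> S" "c > 0" "s \<in> {0..}"
      have "q (\<lambda>x. c * (f1 x + s * h x)) = c * q (\<lambda>x. f1 x + s * h x)"
        by (intro hom addS scaleS * h) (use * in simp)
      moreover have "(\<lambda>x. c * (f1 x + s * h x)) = (\<lambda>x. c * f1 x + (c * s) * h x)"
        by (auto simp: algebra_simps)
      ultimately show "\<exists>u\<in>{0..}. q (\<lambda>x. c * f1 x + u * h x) - u * q h
          \<le> c * (q (\<lambda>x. f1 x + s * h x) - s * q h)"
        using * by (intro bexI[of _ "c * s"]) (auto simp: algebra_simps)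
    qed (use bdd in auto)
    have r_le: "r k \<le> q (\<lambda>x. k x + t * h x) - t * q h" if "k \<in> S" "t \<ge> 0" for k t
      unfolding r_def using that by (intro cINF_lower bdd) auto
    have "\<forall>k\<in>S. r k \<le> q k"
      using r_le[where t=0] by simp
    then have "r f = q f" using min r f by blast
    then have "q f \<le> q (\<lambda>x. f x + h x) - q h"
      using r_le[OF f, of 1] by simp
    then show ?thesis using sub[OF f h] by simp
  qed
  have "q (\<lambda>x. c * f x) = c * q f" if f: "f \<in> S" for f c
  proof (cases "c \<ge> 0")
    case False
    have "q (\<lambda>x. c * f x + - c * f x) = q (\<lambda>x. c * f x) + q (\<lambda>x. - c * f x)"
      by (intro add scaleS f)
    moreover have "q (\<lambda>x. - c * f x) = - c * q f"
      using False by (intro hom f) simp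
    ultimately show ?thesis using sublinear_onD(1)[OF S q] by simp
  qed (use hom[OF f] in simp)
  then show ?thesis using add unfolding linear_on_space_def by blast
qed

text \<open>By Zorn's lemma there is a minimal sublinear functional below \<open>p\<close>, and it is linear. A chain is
  bounded below by its pointwise infimum, which is finite because \<open>q f \<ge> - q (- f) \<ge> - p (- f)\<close>.\<close>

lemma hahn_banach_functions:
  fixes p :: "('x \<Rightarrow> real) \<Rightarrow> real"
  assumes S: "function_space S" and p: "sublinear_on S p"
  obtains L where "linear_on_space S L" "\<And>f. f \<in> S \<Longrightarrow> L f \<le> p f"
proof -
  define A where "A = {q. sublinear_on S q \<and> (\<forall>f\<in>S. q f \<le> p f) \<and> (\<forall>f. f \<notin> S \<longrightarrow> q f = 0)}"
  define P where "P = (\<lambda>q r :: ('x \<Rightarrow> real) \<Rightarrow> real. \<forall>f. r f \<le> q f)"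
  have trunc: "(\<lambda>f. if f \<in> S then q f else 0) \<in> A"
    if "sublinear_on S q" "\<forall>f\<in>S. q f \<le> p f" for q
    using that S unfolding A_def sublinear_on_def function_space_def by auto
  have "\<exists>m\<in>A. \<forall>a\<in>A. P m a \<longrightarrow> a = m"
  proof (rule predicate_Zorn)
    show "partial_order_on A (relation_of P A)"
    proof (rule partial_order_on_relation_ofI)
      show "P a a" for a by (simp add: P_def)
      show "P a c" if "P a b" "P b c" for a b c
        using that unfolding P_def by (meson order_trans)
      show "a = b" if "P a b" "P b a" for a b
        using that unfolding P_def by (meson ext order_antisym)
    qed
  next
    fix C assume C: "C \<in> Chains (relation_of P A)"
    then have CA: "C \<subseteq> A" by (auto simp: Chains_def relation_of_def)
    have lin: "P q r \<or> P r q" if "q \<in> C" "r \<in> C" for q r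
      using C that by (auto simp: Chains_def relation_of_def)
    show "\<exists>u\<in>A. \<forall>a\<in>C. P a u"
    proof (cases "C = {}")
      case True
      then show ?thesis using trunc[OF p] by auto
    next
      case False
      have bdd: "bdd_below ((\<lambda>q. q f) ` C)" if f: "f \<in> S" for f
      proof (rule bdd_belowI2)
        fix q assume "q \<in> C"
        then have q: "sublinear_on S q" "\<forall>f\<in>S. q f \<le> p f" using CA A_def by auto
        have "(\<lambda>x. -1 * f x) \<in> S" using function_space_scale[OF S f] .
        then have "q (\<lambda>x. - f x) \<le> p (\<lambda>x. - f x)" using q by simp
        then show "- p (\<lambda>x. - f x) \<le> q f" using sublinear_onD(2)[OF S q(1) f] by simp
      qed
      let ?r = "\<lambda>f. INF q\<in>C. q f"
      have r: "sublinear_on S ?r"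
      proof (rule sublinear_on_INF[OF S False bdd])
        fix f h q1 q2 assume *: "f \<in> S" "h \<in> S" "q1 \<in> C" "q2 \<in> C"
        obtain q where q: "q \<in> C" "P q1 q" "P q2 q"
          using lin[OF *(3,4)] * by (auto simp: P_def)
        then have "q (\<lambda>x. f x + h x) \<le> q f + q h"
          using CA by (intro sublinear_on_add[OF _ *(1,2)]) (auto simp: A_def)
        also have "\<dots> \<le> q1 f + q2 h" using q by (auto simp: P_def intro: add_mono)
        finally show "\<exists>k\<in>C. k (\<lambda>x. f x + h x) \<le> q1 f + q2 h" using q by blast
      next
        fix f c q assume "f \<in> S" "c > (0::real)" "q \<in> C"
        then show "\<exists>k\<in>C. k (\<lambda>x. c * f x) \<le> c * q f"
          using CA by (intro bexI[of _ q] sublinear_on_scale) (auto simp: A_def)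
      qed
      have r_le: "?r f \<le> q f" if "q \<in> C" "f \<in> S" for q f
        using bdd that by (intro cINF_lower) auto
      obtain q0 where "q0 \<in> C" using False by auto
      then have "\<forall>f\<in>S. ?r f \<le> p f"
        using r_le CA unfolding A_def by fastforce
      then have "(\<lambda>f. if f \<in> S then ?r f else 0) \<in> A" by (rule trunc[OF r])
      moreover have "\<forall>a\<in>C. P a (\<lambda>f. if f \<in> S then ?r f else 0)"
        using r_le CA by (auto simp: P_def A_def)
      ultimately show ?thesis by blast
    qed
  qed
  then obtain m where m: "m \<in> A" "\<And>a. a \<in> A \<Longrightarrow> P m a \<Longrightarrow> a = m" by blast
  have "linear_on_space S m"
  proof (rule minimal_sublinear_imp_linear[OF S])
    show "sublinear_on S m" using m A_def by simp
    fix r f assume r: "sublinear_on S r" "\<forall>f\<in>S. r f \<le> m f" and f: "f \<in> S"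
    have "\<forall>f\<in>S. r f \<le> p f" using r m(1) unfolding A_def by fastforce
    from trunc[OF r(1) this] have "(\<lambda>f. if f \<in> S then r f else 0) = m"
      using r m by (intro m(2)) (auto simp: P_def A_def)
    then have "(if f \<in> S then r f else 0) = m f" by (rule fun_cong)
    then show "r f = m f" using f by simp
  qed
  then show ?thesis using that[of m] m(1) A_def by auto
qed

section \<open>Finitely additive means on bounded functions\<close>

definition bounded_functions :: "'x set \<Rightarrow> ('x \<Rightarrow> real) set" where
  "bounded_functions X = {f. bounded (f ` X)}"

lemma bounded_functionsI: "(\<And>x. x \<in> X \<Longrightarrow> \<bar>f x\<bar> \<le> b) \<Longrightarrow> f \<in> bounded_functions X"
  by (auto simp: bounded_functions_def bounded_iff)

lemma bounded_functionsE:
  assumes "f \<in> bounded_functions X"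
  obtains b where "b > 0" "\<And>x. x \<in> X \<Longrightarrow> \<bar>f x\<bar> \<le> b"
  using assms by (auto simp: bounded_functions_def bounded_pos)

lemma function_space_bounded_functions: "function_space (bounded_functions X)"
  unfolding function_space_def
proof (intro conjI ballI allI)
  have "(\<lambda>x. 0) \<in> bounded_functions X" by (rule bounded_functionsI[of _ _ 0]) simp
  then show "bounded_functions X \<noteq> {}" by blast
next
  fix f h assume "f \<in> bounded_functions X" "h \<in> bounded_functions X"
  then obtain a b where "\<And>x. x \<in> X \<Longrightarrow> \<bar>f x\<bar> \<le> a" "\<And>x. x \<in> X \<Longrightarrow> \<bar>h x\<bar> \<le> b"
    by (metis bounded_functionsE)
  then show "(\<lambda>x. f x + h x) \<in> bounded_functions X"
    by (intro bounded_functionsI[of _ _ "a + b"]) (force intro: order_trans[OF abs_triangle_ineq] add_mono)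
next
  fix f c assume "f \<in> bounded_functions X"
  then obtain a where "\<And>x. x \<in> X \<Longrightarrow> \<bar>f x\<bar> \<le> a"
    by (metis bounded_functionsE)
  then show "(\<lambda>x. c * f x) \<in> bounded_functions X"
    by (intro bounded_functionsI[of _ _ "\<bar>c\<bar> * a"]) (simp add: abs_mult mult_left_mono)
qed

text \<open>The upper bound also gives the lower bound, by passing to \<open>- f\<close>.\<close>

definition mean_on :: "'x set \<Rightarrow> (('x \<Rightarrow> real) \<Rightarrow> real) \<Rightarrow> bool" where
  "mean_on X L \<longleftrightarrow> linear_on_space (bounded_functions X) L \<and>
     (\<forall>f\<in>bounded_functions X. \<forall>b. (\<forall>x\<in>X. f x \<le> b) \<longrightarrow> L f \<le> b)"

lemma mean_on_add:
  "mean_on X L \<Longrightarrow> f \<in> bounded_functions X \<Longrightarrow> h \<in> bounded_functions X \<Longrightarrow>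
    L (\<lambda>x. f x + h x) = L f + L h"
  by (simp add: mean_on_def linear_on_space_def)

lemma mean_on_scale:
  "mean_on X L \<Longrightarrow> f \<in> bounded_functions X \<Longrightarrow> L (\<lambda>x. c * f x) = c * L f"
  by (simp add: mean_on_def linear_on_space_def)

lemma mean_on_upper:
  "mean_on X L \<Longrightarrow> f \<in> bounded_functions X \<Longrightarrow> (\<And>x. x \<in> X \<Longrightarrow> f x \<le> b) \<Longrightarrow> L f \<le> b"
  by (simp add: mean_on_def)

lemma mean_on_lower:
  assumes L: "mean_on X L" and f: "f \<in> bounded_functions X" and b: "\<And>x. x \<in> X \<Longrightarrow> b \<le> f x"
  shows "b \<le> L f"
proof -
  have "L (\<lambda>x. -1 * f x) \<le> - b"
    using b by (intro mean_on_upper[OF L] function_space_scale[OF function_space_bounded_functions] f) auto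
  then show ?thesis using mean_on_scale[OF L f, of "-1"] by simp
qed

lemma mean_on_cong:
  assumes L: "mean_on X L" and f: "f \<in> bounded_functions X" and h: "h \<in> bounded_functions X"
    and eq: "\<And>x. x \<in> X \<Longrightarrow> f x = h x"
  shows "L f = L h"
proof -
  note S = function_space_bounded_functions[of X]
  have h': "(\<lambda>x. -1 * h x) \<in> bounded_functions X" by (rule function_space_scale[OF S h])
  have d: "(\<lambda>x. f x + -1 * h x) \<in> bounded_functions X" by (rule function_space_add[OF S f h'])
  have "L (\<lambda>x. f x + -1 * h x) = 0"
    by (intro order_antisym mean_on_upper[OF L d] mean_on_lower[OF L d]; simp add: eq)
  then show ?thesis
    using mean_on_add[OF L f h'] mean_on_scale[OF L h, of "-1"] by simp
qed

text \<open>A separation theorem that serves twice: to produce the invariant mean, and as a minimax theorem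
  (with \<open>X\<close> a set of functions) in the contraction step. The functional
  \<open>p f = inf {sup (f + d) | d \<in> D}\<close> is finite because every element of \<open>D\<close> has supremum at
  least \<open>0\<close>, and a linear functional below \<open>p\<close> satisfies \<open>L f \<le> sup f\<close>, as \<open>0 \<in> D\<close>, and
  \<open>L (- d) \<le> sup (- d + d) = 0\<close>.\<close>

lemma mean_nonneg_on_cone:
  fixes D :: "('x \<Rightarrow> real) set"
  assumes X: "X \<noteq> {}"
    and D: "D \<subseteq> bounded_functions X" "D \<noteq> {}"
    and add: "\<And>d e. d \<in> D \<Longrightarrow> e \<in> D \<Longrightarrow> (\<lambda>x. d x + e x) \<in> D"
    and scale: "\<And>d c. d \<in> D \<Longrightarrow> c \<ge> 0 \<Longrightarrow> (\<lambda>x. c * d x) \<in> D"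
    and pos: "\<And>d e. d \<in> D \<Longrightarrow> e > 0 \<Longrightarrow> \<exists>x\<in>X. - e \<le> d x"
  obtains L where "mean_on X L" and "\<And>d. d \<in> D \<Longrightarrow> 0 \<le> L d"
proof -
  let ?B = "bounded_functions X"
  note S = function_space_bounded_functions[of X]
  let ?\<phi> = "\<lambda>d f. SUP x\<in>X. f x + d x"
  define p where "p = (\<lambda>f. INF d\<in>D. ?\<phi> d f)"
  have bdd_above: "bdd_above ((\<lambda>x. f x) ` X)" if f: "f \<in> ?B" for f
    using f by (auto simp: bounded_functions_def intro: bounded_imp_bdd_above)
  have upper: "f x + d x \<le> ?\<phi> d f" if "f \<in> ?B" "d \<in> D" "x \<in> X" for f d x
    using that D(1) by (intro cSUP_upper bdd_above function_space_add[OF S]) auto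
  have low: "- b \<le> ?\<phi> d f" if f: "f \<in> ?B" and d: "d \<in> D" and b: "\<And>x. x \<in> X \<Longrightarrow> \<bar>f x\<bar> \<le> b" for f d b
  proof (rule field_le_epsilon)
    fix e :: real assume "e > 0"
    then obtain x where x: "x \<in> X" "- e \<le> d x" using pos[OF d] by blast
    then show "- b \<le> ?\<phi> d f + e" using upper[OF f d x(1)] b[OF x(1)] by linarith
  qed
  have bdd: "bdd_below ((\<lambda>d. ?\<phi> d f) ` D)" if f: "f \<in> ?B" for f
  proof -
    obtain b where "\<And>x. x \<in> X \<Longrightarrow> \<bar>f x\<bar> \<le> b" using f by (metis bounded_functionsE)
    then show ?thesis by (intro bdd_belowI2[of _ "- b"] low[OF f])
  qed
  have "sublinear_on ?B p"
    unfolding p_def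
  proof (rule sublinear_on_INF[OF S D(2) bdd])
    fix f h d e assume *: "f \<in> ?B" "h \<in> ?B" "d \<in> D" "e \<in> D"
    have "?\<phi> (\<lambda>x. d x + e x) (\<lambda>x. f x + h x) \<le> ?\<phi> d f + ?\<phi> e h"
    proof (rule cSUP_least[OF X])
      fix x assume x: "x \<in> X"
      show "f x + h x + (d x + e x) \<le> ?\<phi> d f + ?\<phi> e h"
        using upper[OF *(1,3) x] upper[OF *(2,4) x] by linarith
    qed
    then show "\<exists>k\<in>D. ?\<phi> k (\<lambda>x. f x + h x) \<le> ?\<phi> d f + ?\<phi> e h"
      using add[OF *(3,4)] by (intro bexI[of _ "\<lambda>x. d x + e x"])
  next
    fix f d and c :: real assume *: "f \<in> ?B" "c > 0" "d \<in> D"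
    have "?\<phi> (\<lambda>x. c * d x) (\<lambda>x. c * f x) \<le> c * ?\<phi> d f"
    proof (rule cSUP_least[OF X])
      fix x assume x: "x \<in> X"
      have "c * (f x + d x) \<le> c * ?\<phi> d f"
        using upper[OF *(1,3) x] *(2) by (intro mult_left_mono) auto
      then show "c * f x + c * d x \<le> c * ?\<phi> d f" by (simp add: distrib_left)
    qed
    then show "\<exists>k\<in>D. ?\<phi> k (\<lambda>x. c * f x) \<le> c * ?\<phi> d f"
      using scale[OF *(3), of c] *(2) by (intro bexI[of _ "\<lambda>x. c * d x"]) auto
  qed
  then obtain L where L: "linear_on_space ?B L" "\<And>f. f \<in> ?B \<Longrightarrow> L f \<le> p f"
    using hahn_banach_functions[OF S] by blast
  have L_le: "L f \<le> b" if f: "f \<in> ?B" and d: "d \<in> D" and b: "\<And>x. x \<in> X \<Longrightarrow> f x + d x \<le> b" for f d b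
  proof -
    have "p f \<le> ?\<phi> d f" unfolding p_def by (rule cINF_lower[OF bdd[OF f] d])
    also have "\<dots> \<le> b" by (rule cSUP_least[OF X b])
    finally show ?thesis using L(2)[OF f] by linarith
  qed
  have neg: "L (\<lambda>x. - f x) = - L f" "(\<lambda>x. - f x) \<in> ?B" if "f \<in> ?B" for f
  proof -
    have "L (\<lambda>x. -1 * f x) = -1 * L f" using L(1) that unfolding linear_on_space_def by blast
    then show "L (\<lambda>x. - f x) = - L f" by simp
    show "(\<lambda>x. - f x) \<in> ?B" using function_space_scale[OF S that, of "-1"] by simp
  qed
  obtain d0 where "d0 \<in> D" using D(2) by blast
  then have zero: "(\<lambda>x. 0) \<in> D" using scale[of d0 0] by simp
  show thesis
  proof (rule that)
    show "mean_on X L"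
      using L(1) L_le[OF _ zero] by (simp add: mean_on_def)
    show "0 \<le> L d" if "d \<in> D" for d
      using L_le[OF neg(2) that, of d 0] neg(1)[of d] that D(1) by auto
  qed
qed

section \<open>Finitely supported measures on a group and the contraction argument\<close>

text \<open>A list of weighted points stands for the finitely supported signed measure
  \<open>\<Sum> c \<cdot> \<delta>\<^sub>x\<close>. Points may be repeated, which makes convolution a plain list operation.\<close>

definition integ :: "(real \<times> 'a) list \<Rightarrow> ('a \<Rightarrow> real) \<Rightarrow> real" where
  "integ m f = (\<Sum>(c, x)\<leftarrow>m. c * f x)"

definition total_variation :: "(real \<times> 'a) list \<Rightarrow> real" where
  "total_variation m = (\<Sum>(c, x)\<leftarrow>m. \<bar>c\<bar>)"

lemma integ_Nil [simp]: "integ [] f = 0"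
  and integ_Cons [simp]: "integ ((c, x) # m) f = c * f x + integ m f"
  and integ_append [simp]: "integ (m @ m') f = integ m f + integ m' f"
  by (simp_all add: integ_def)

lemma integ_add: "integ m (\<lambda>x. f x + h x) = integ m f + integ m h"
  by (induction m) (auto simp: algebra_simps)

lemma integ_diff: "integ m (\<lambda>x. f x - h x) = integ m f - integ m h"
  by (induction m) (auto simp: algebra_simps)

lemma integ_scale: "integ m (\<lambda>x. c * f x) = c * integ m f"
  by (induction m) (auto simp: algebra_simps)

lemma integ_const: "integ m (\<lambda>x. c) = c * integ m (\<lambda>x. 1)"
  using integ_scale[of m c "\<lambda>_. 1"] by simp

lemma integ_scale_weights: "integ (map (\<lambda>(c, x). (t * c, x)) m) f = t * integ m f"
  by (induction m) (auto simp: algebra_simps)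

lemma integ_sum: "integ m (\<lambda>g. \<Sum>x\<in>F. k g x) = (\<Sum>x\<in>F. integ m (\<lambda>g. k g x))"
  by (induction m) (auto simp: sum_distrib_left sum.distrib)

lemma integ_zero [simp]: "integ m (\<lambda>x. 0) = 0"
  by (induction m) auto

lemma integ_swap: "integ m (\<lambda>g. integ w (\<lambda>x. k g x)) = integ w (\<lambda>x. integ m (\<lambda>g. k g x))"
  by (induction m) (auto simp: integ_add integ_scale)

lemma integ_cong:
  assumes "\<And>x. x \<in> snd ` set m \<Longrightarrow> f x = h x"
  shows "integ m f = integ m h"
  using assms by (induction m) auto

lemma abs_integ_le:
  assumes "\<And>x. x \<in> snd ` set m \<Longrightarrow> \<bar>f x\<bar> \<le> b"
  shows "\<bar>integ m f\<bar> \<le> b * total_variation m"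
  using assms
proof (induction m)
  case (Cons p m)
  obtain c x where p: "p = (c, x)" by (cases p)
  have "\<bar>c * f x + integ m f\<bar> \<le> \<bar>c\<bar> * \<bar>f x\<bar> + \<bar>integ m f\<bar>"
    by (metis abs_mult abs_triangle_ineq)
  also have "\<dots> \<le> \<bar>c\<bar> * b + b * total_variation m"
    using Cons by (intro add_mono mult_left_mono) (auto simp: p)
  finally show ?case by (simp add: p total_variation_def algebra_simps)
qed (simp add: total_variation_def)

lemma total_variation_nonneg: "0 \<le> total_variation m"
  by (induction m) (auto simp: total_variation_def)

lemma total_variation_nonneg_weights:
  assumes "\<And>c x. (c, x) \<in> set m \<Longrightarrow> c \<ge> 0"
  shows "total_variation m = integ m (\<lambda>_. 1)"
  using assms by (induction m) (force simp: total_variation_def)+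

context group
begin

definition positive_measure :: "(real \<times> 'a) list \<Rightarrow> bool" where
  "positive_measure w \<longleftrightarrow> snd ` set w \<subseteq> carrier G \<and> (\<forall>(c, x)\<in>set w. c \<ge> 0)"

definition probability :: "(real \<times> 'a) list \<Rightarrow> bool" where
  "probability w \<longleftrightarrow> positive_measure w \<and> integ w (\<lambda>_. 1) = 1"

definition convolution :: "(real \<times> 'a) list \<Rightarrow> (real \<times> 'a) list \<Rightarrow> (real \<times> 'a) list" where
  "convolution m w = concat (map (\<lambda>(c, g). map (\<lambda>(d, x). (c * d, g \<otimes> x)) w) m)"

text \<open>Integration against a convolution is iterated integration. Together with Fubini's theorem for
  finite sums (\<open>integ_swap\<close>) this lets either factor be integrated out first.\<close>

lemma integ_convolution:
  "integ (convolution m w) f = integ m (\<lambda>g. integ w (\<lambda>x. f (g \<otimes> x)))"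
proof -
  have "integ (map (\<lambda>(d, x). (c * d, g \<otimes> x)) w) f = c * integ w (\<lambda>x. f (g \<otimes> x))" for c g
    by (induction w) (auto simp: algebra_simps)
  then show ?thesis
    unfolding convolution_def by (induction m) auto
qed

lemma convolution_carrier:
  "snd ` set m \<subseteq> carrier G \<Longrightarrow> snd ` set w \<subseteq> carrier G \<Longrightarrow>
    snd ` set (convolution m w) \<subseteq> carrier G"
  unfolding convolution_def by force

lemma positive_measure_total_variation:
  "positive_measure w \<Longrightarrow> total_variation w = integ w (\<lambda>_. 1)"
  by (rule total_variation_nonneg_weights) (auto simp: positive_measure_def)

lemma probability_convolution:
  assumes "probability v" "probability w"
  shows "probability (convolution v w)"
proof -
  have "integ (convolution v w) (\<lambda>_. 1) = 1"
    using assms by (simp add: integ_convolution probability_def)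
  moreover have "snd ` set (convolution v w) \<subseteq> carrier G"
    using assms by (intro convolution_carrier) (auto simp: probability_def positive_measure_def)
  moreover have "\<forall>(c, x)\<in>set (convolution v w). c \<ge> 0"
    using assms by (fastforce simp: probability_def positive_measure_def convolution_def)
  ultimately show ?thesis by (simp add: probability_def positive_measure_def)
qed

lemma abs_integ_probability_le:
  assumes "probability w" "\<And>x. x \<in> carrier G \<Longrightarrow> \<bar>f x\<bar> \<le> b"
  shows "\<bar>integ w f\<bar> \<le> b"
proof -
  have "\<bar>integ w f\<bar> \<le> b * total_variation w"
    using assms by (intro abs_integ_le) (auto simp: probability_def positive_measure_def)
  then show ?thesis
    using assms by (simp add: probability_def positive_measure_total_variation)
qed

lemma integ_probability_le:
  assumes "probability w" "\<And>x. x \<in> carrier G \<Longrightarrow> f x \<le> b"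
  shows "integ w f \<le> b"
proof -
  have "integ v f \<le> b * integ v (\<lambda>_. 1)" if "positive_measure v" for v
    using that
  proof (induction v)
    case (Cons p v)
    obtain c x where p: "p = (c, x)" by (cases p)
    have "c * f x \<le> c * b"
      using Cons.prems assms(2) by (intro mult_left_mono) (auto simp: p positive_measure_def)
    moreover have "integ v f \<le> b * integ v (\<lambda>_. 1)"
      using Cons by (auto simp: positive_measure_def)
    ultimately show ?case by (simp add: p algebra_simps)
  qed simp
  from this[of w] show ?thesis using assms(1) by (simp add: probability_def)
qed

text \<open>These are the functions from \<open>H \ G\<close> to the unit interval. For a measure \<open>m\<close> of total mass \<open>0\<close>
  the supremum of \<open>integ m\<close> over them is half the norm of the image of \<open>m\<close> in the space of
  summable functions on \<open>H \ G\<close>.\<close>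

definition invariant_functions :: "'a set \<Rightarrow> ('a \<Rightarrow> real) set" where
  "invariant_functions H =
     {f. \<forall>x\<in>carrier G. 0 \<le> f x \<and> f x \<le> 1 \<and> (\<forall>h\<in>H. f (h \<otimes> x) = f x)}"

text \<open>Left invariance under \<open>H\<close> survives right translations, but not left translations, which replace
  \<open>H\<close> by a conjugate. This is why the measures constructed below are improved by multiplying them
  from the right.\<close>

lemma invariant_functions_right_translate:
  assumes "f \<in> invariant_functions H" "H \<subseteq> carrier G" "x \<in> carrier G"
  shows "(\<lambda>g. f (g \<otimes> x)) \<in> invariant_functions H"
  using assms by (auto simp: invariant_functions_def m_assoc subsetD)

definition folner_on_sets :: "'a set \<Rightarrow> bool" where
  "folner_on_sets H \<longleftrightarrow> (\<forall>\<epsilon>>0. \<forall>A. A \<subseteq> carrier G \<longrightarrow> (\<forall>E. E \<subseteq> carrier G \<and> finite E \<longrightarrow>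
     (\<exists>F. F \<subseteq> carrier G \<and> finite F \<and> F \<noteq> {} \<and>
       (\<forall>g\<in>E. \<bar>real (card (F \<inter> (H <#> A))) - real (card ((g <# F) \<inter> (H <#> A)))\<bar>
          \<le> \<epsilon> * real (card F)))))"

lemma card_left_translate_Int:
  assumes F: "F \<subseteq> carrier G" and g: "g \<in> carrier G"
  shows "card ((g <# F) \<inter> A) = card {x\<in>F. g \<otimes> x \<in> A}"
proof -
  have "(g <# F) \<inter> A = (\<lambda>x. g \<otimes> x) ` {x\<in>F. g \<otimes> x \<in> A}"
    by (auto simp: l_coset_def)
  moreover have "inj_on (\<lambda>x. g \<otimes> x) {x\<in>F. g \<otimes> x \<in> A}"
    using F by (intro inj_on_subset[OF inj_on_cmult[OF g]]) blast
  ultimately show ?thesis by (simp add: card_image)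
qed

lemma sum_indicator_left_translate:
  assumes "F \<subseteq> carrier G" "finite F" "g \<in> carrier G"
  shows "(\<Sum>x\<in>F. indicator A (g \<otimes> x)) = real (card ((g <# F) \<inter> A))"
proof -
  have "(\<Sum>x\<in>F. indicator A (g \<otimes> x)) = real (card {x\<in>F. g \<otimes> x \<in> A})"
    using assms(2) by (simp add: indicator_def sum.If_cases Int_def flip: of_bool_def)
  then show ?thesis by (simp only: card_left_translate_Int[OF assms(1,3)])
qed

text \<open>Averaging over a Folner set of \<open>A\<close> for the support of \<open>m\<close> makes the translates of \<open>A\<close> almost
  equally large, so that a measure of total mass \<open>0\<close> nearly cancels.\<close>

lemma folner_on_sets_average:
  assumes F: "folner_on_sets H" and A: "A \<subseteq> carrier G" "H <#> A = A"
    and m: "snd ` set m \<subseteq> carrier G" "integ m (\<lambda>_. 1) = 0"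
    and lower: "\<And>x. x \<in> carrier G \<Longrightarrow> b \<le> integ m (\<lambda>g. indicator A (g \<otimes> x))"
  shows "b \<le> 0"
proof (rule ccontr)
  assume "\<not> b \<le> 0"
  then have b: "b > 0" by simp
  define tv where "tv = total_variation m"
  have tv: "tv \<ge> 0" unfolding tv_def by (rule total_variation_nonneg)
  \<comment> \<open>Small enough for \<open>\<epsilon> \<cdot> tv < b\<close>; adding \<open>1\<close> covers the case that \<open>m\<close> is zero.\<close>
  define \<epsilon> where "\<epsilon> = b / (2 * (tv + 1))"
  have "\<epsilon> > 0" using b tv by (simp add: \<epsilon>_def)
  moreover have "snd ` set m \<subseteq> carrier G \<and> finite (snd ` set m)" using m by simp
  ultimately obtain F where F: "F \<subseteq> carrier G" "finite F" "F \<noteq> {}"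
    and fol: "\<And>g. g \<in> snd ` set m \<Longrightarrow>
      \<bar>real (card (F \<inter> A)) - real (card ((g <# F) \<inter> A))\<bar> \<le> \<epsilon> * real (card F)"
    using F[unfolded folner_on_sets_def, rule_format, of \<epsilon> A "snd ` set m"] A by metis
  have "real (card F) * b = (\<Sum>x\<in>F. b)" by simp
  also have "\<dots> \<le> (\<Sum>x\<in>F. integ m (\<lambda>g. indicator A (g \<otimes> x)))"
    using F by (intro sum_mono lower) auto
  also have "\<dots> = integ m (\<lambda>g. \<Sum>x\<in>F. indicator A (g \<otimes> x))"
    by (simp add: integ_sum)
  also have "\<dots> = integ m (\<lambda>g. real (card ((g <# F) \<inter> A)))"
    using m F by (intro integ_cong) (simp add: sum_indicator_left_translate subset_iff)
  also have "\<dots> = integ m (\<lambda>g. real (card ((g <# F) \<inter> A)) - real (card (F \<inter> A)))"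
    using m(2) integ_const[of m "real (card (F \<inter> A))"] by (simp add: integ_diff)
  also have "\<dots> \<le> \<epsilon> * real (card F) * tv"
    unfolding tv_def using fol by (intro order_trans[OF abs_ge_self abs_integ_le]) (simp add: abs_minus_commute)
  finally have "real (card F) * b \<le> real (card F) * (\<epsilon> * tv)" by (simp add: mult_ac)
  then have "b \<le> \<epsilon> * tv" using F by (simp add: card_gt_0_iff)
  also have "\<dots> < b"
  proof -
    have "b * tv < b * (2 * (tv + 1))" using b tv by (intro mult_strict_left_mono) auto
    then show ?thesis using tv by (simp add: \<epsilon>_def field_simps)
  qed
  finally show False by simp
qed

lemma integ_bounded_on_invariant_functions:
  assumes "snd ` set m \<subseteq> carrier G"
  shows "integ m \<in> bounded_functions (invariant_functions H)"
proof (rule bounded_functionsI)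
  fix f assume "f \<in> invariant_functions H"
  then have "\<bar>f x\<bar> \<le> 1" if "x \<in> carrier G" for x
    using that by (auto simp: invariant_functions_def)
  then show "\<bar>integ m f\<bar> \<le> 1 * total_variation m"
    using assms by (intro abs_integ_le) blast
qed

text \<open>A mean on functionals, evaluated at the point evaluations, is a function, and integration
  of that function is recovered from the mean by linearity.\<close>

lemma mean_of_integ:
  assumes L: "mean_on (invariant_functions H) L"
    and m: "snd ` set m \<subseteq> carrier G"
  shows "L (integ m) = integ m (\<lambda>x. L (\<lambda>f. f x))"
  using m
proof (induction m)
  case Nil
  have one: "(\<lambda>f. 1) \<in> bounded_functions (invariant_functions H)"
    by (intro bounded_functionsI[of _ _ 1]) auto
  have "L (\<lambda>f. 0 * 1) = 0 * L (\<lambda>f. 1)"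
    by (rule mean_on_scale[OF L one])
  then show ?case by (simp add: integ_def[abs_def])
next
  note S = function_space_bounded_functions[of "invariant_functions H"]
  case (Cons p m)
  obtain c x where p: "p = (c, x)" by (cases p)
  have x: "(\<lambda>f. f x) \<in> bounded_functions (invariant_functions H)"
    using Cons.prems p by (intro bounded_functionsI[of _ _ 1]) (auto simp: invariant_functions_def)
  have cx: "(\<lambda>f. c * f x) \<in> bounded_functions (invariant_functions H)"
    by (rule function_space_scale[OF S x])
  have m: "integ m \<in> bounded_functions (invariant_functions H)"
    using Cons.prems by (intro integ_bounded_on_invariant_functions) auto
  have "integ (p # m) = (\<lambda>f. c * f x + integ m f)" by (auto simp: p)
  then have "L (integ (p # m)) = L (\<lambda>f. c * f x) + L (integ m)"
    using mean_on_add[OF L cx m] by simp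
  also have "L (\<lambda>f. c * f x) = c * L (\<lambda>f. f x)"
    by (rule mean_on_scale[OF L x])
  finally show ?case using Cons by (simp add: p)
qed

text \<open>If no \<open>w\<close> worked, the minimax argument would provide a single \<open>f0 \<in> invariant_functions H\<close> whose
  right translates all have \<open>m\<close>-integral at least \<open>3/4 \<cdot> b\<close>. Let \<open>A\<close> be the set where
  \<open>f0 \<ge> 1/2\<close>. The function \<open>2 f0 - 1\<^sub>A\<close> is again \<open>H\<close>-invariant with values in the unit interval, so
  its integrals are at most \<open>b\<close>, and the indicator of \<open>A\<close> has all integrals at least
  \<open>2 \<cdot> 3/4 \<cdot> b - b = b/2 > 0\<close>, which contradicts the Folner condition for the single set \<open>A\<close>. Any
  factor strictly between \<open>1/2\<close> and \<open>1\<close> could replace \<open>3/4\<close>.\<close>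

lemma contraction_step:
  assumes H: "subgroup H G" and fol: "folner_on_sets H"
    and m: "snd ` set m \<subseteq> carrier G" "integ m (\<lambda>_. 1) = 0"
    and b: "b > 0" and bound: "\<And>f. f \<in> invariant_functions H \<Longrightarrow> integ m f \<le> b"
  obtains w where "probability w"
    and "\<And>f. f \<in> invariant_functions H \<Longrightarrow> integ (convolution m w) f \<le> 3/4 * b"
proof (rule ccontr)
  note contracts = that
  assume "\<not> thesis"
  have no: "\<exists>f\<in>invariant_functions H. integ (convolution m w) f > 3/4 * b"
    if w: "probability w" for w
    using contracts[OF w] \<open>\<not> thesis\<close> by (meson not_le)
  let ?X = "invariant_functions H"
  let ?B = "bounded_functions ?X"
  note S = function_space_bounded_functions[of ?X]
  have HG: "H \<subseteq> carrier G" using H by (rule subgroup.subset)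
  \<comment> \<open>The elements of the cone \<open>D\<close> are the nonnegative multiples of \<open>integ (convolution m w) - 3/4 \<cdot> b\<close> with
      \<open>w\<close> a probability measure, written with unnormalised \<open>w\<close> so that addition is concatenation.\<close>
  define gap where "gap = (\<lambda>w f. integ (convolution m w) f - 3/4 * b * integ w (\<lambda>_. 1))"
  define D where "D = gap ` Collect positive_measure"
  have zero: "(\<lambda>x. 0) \<in> ?X" by (simp add: invariant_functions_def)
  have conv_carrier: "snd ` set (convolution m w) \<subseteq> carrier G" if "positive_measure w" for w
    using that m(1) by (intro convolution_carrier) (auto simp: positive_measure_def)
  have gap_append: "gap (v @ w) f = gap v f + gap w f" for v w f
    by (simp add: gap_def integ_convolution integ_add algebra_simps)
  have gap_scale: "gap (map (\<lambda>(d, x). (c * d, x)) w) f = c * gap w f" for c w f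
    unfolding gap_def integ_convolution integ_scale_weights integ_scale
    by (simp add: algebra_simps)
  have const: "(\<lambda>f. c) \<in> ?B" for c by (rule bounded_functionsI[of _ _ "\<bar>c\<bar>"]) simp
  note int_bdd = integ_bounded_on_invariant_functions
  have gap_eq: "gap w = (\<lambda>f. integ (convolution m w) f + (- (3/4 * b * integ w (\<lambda>_. 1))))" for w
    by (simp add: gap_def)
  have D_bdd: "D \<subseteq> ?B"
    unfolding D_def
  proof (clarify)
    fix w assume w: "positive_measure w"
    show "gap w \<in> ?B"
      unfolding gap_eq by (rule function_space_add[OF S int_bdd const]) (rule conv_carrier[OF w])
  qed
  obtain L where L: "mean_on ?X L" and LD: "\<And>d. d \<in> D \<Longrightarrow> 0 \<le> L d"
  proof (rule mean_nonneg_on_cone[of ?X D])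
    show "?X \<noteq> {}" using zero by blast
    show "D \<subseteq> ?B" by (rule D_bdd)
    show "D \<noteq> {}" by (auto simp: D_def positive_measure_def intro: exI[of _ "[]"])
    show "(\<lambda>x. d x + e x) \<in> D" if de: "d \<in> D" "e \<in> D" for d e
    proof -
      obtain v w where vw: "positive_measure v" "d = gap v" "positive_measure w" "e = gap w"
        using de by (auto simp: D_def)
      then have "positive_measure (v @ w)" by (auto simp: positive_measure_def)
      moreover have "(\<lambda>x. d x + e x) = gap (v @ w)" using vw gap_append by auto
      ultimately show ?thesis by (auto simp: D_def)
    qed
    show "(\<lambda>x. c * d x) \<in> D" if d: "d \<in> D" "c \<ge> 0" for d c
    proof -
      obtain w where w: "positive_measure w" "d = gap w" using d by (auto simp: D_def)
      then have "positive_measure (map (\<lambda>(d, x). (c * d, x)) w)"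
        using d by (force simp: positive_measure_def)
      moreover have "(\<lambda>x. c * d x) = gap (map (\<lambda>(d, x). (c * d, x)) w)" using w gap_scale by auto
      ultimately show ?thesis by (auto simp: D_def)
    qed
    show "\<exists>f\<in>?X. - e \<le> d f" if "d \<in> D" "e > 0" for d e
    proof -
      obtain w where w: "positive_measure w" "d = gap w" using \<open>d \<in> D\<close> by (auto simp: D_def)
      define s where "s = integ w (\<lambda>_. 1)"
      have s: "s = total_variation w" "s \<ge> 0"
        using positive_measure_total_variation[OF w(1)] total_variation_nonneg[of w]
        by (simp_all add: s_def)
      show ?thesis
      proof (cases "s = 0")
        case True
        have "integ (convolution m w) (\<lambda>x. 0) = 0" by simp
        then have "d (\<lambda>x. 0) = 0" using True by (simp add: w gap_def s_def)
        then show ?thesis using zero \<open>e > 0\<close> by (intro bexI[of _ "\<lambda>x. 0"]) auto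
      next
        case False
        define v where "v = map (\<lambda>(d, x). (inverse s * d, x)) w"
        have "probability v"
          using w False s unfolding probability_def v_def integ_scale_weights
          by (force simp: positive_measure_def simp flip: s_def)
        then obtain f where f: "f \<in> ?X" "integ (convolution m v) f > 3/4 * b" using no by blast
        have "gap v f = inverse s * d f" by (simp add: v_def gap_scale w)
        moreover have "gap v f > 0"
          using f \<open>probability v\<close> by (simp add: gap_def probability_def)
        ultimately have "d f > 0" using s False by (simp add: zero_less_mult_iff)
        then show ?thesis using f \<open>e > 0\<close> by (intro bexI[of _ f]) auto
      qed
    qed
  qed blast
  define f0 where "f0 = (\<lambda>x. L (\<lambda>f. f x))"
  have ev: "(\<lambda>f. f x) \<in> ?B" if "x \<in> carrier G" for x
    using that by (intro bounded_functionsI[of _ _ 1]) (auto simp: invariant_functions_def)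
  have f0: "f0 \<in> ?X"
    unfolding invariant_functions_def
  proof (intro CollectI ballI conjI)
    fix x assume x: "x \<in> carrier G"
    show "0 \<le> f0 x"
      unfolding f0_def by (rule mean_on_lower[OF L ev[OF x]]) (use x in \<open>simp add: invariant_functions_def\<close>)
    show "f0 x \<le> 1"
      unfolding f0_def by (rule mean_on_upper[OF L ev[OF x]]) (use x in \<open>simp add: invariant_functions_def\<close>)
    fix h assume h: "h \<in> H"
    then have hx: "h \<otimes> x \<in> carrier G" using x HG by auto
    show "f0 (h \<otimes> x) = f0 x"
      unfolding f0_def by (rule mean_on_cong[OF L ev[OF hx] ev[OF x]])
        (use h x in \<open>simp add: invariant_functions_def\<close>)
  qed
  \<comment> \<open>\<open>L\<close> is nonnegative on the element of the cone given by \<open>w = \<delta>\<^sub>x\<close>.\<close>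
  have f0_ge: "3/4 * b \<le> integ m (\<lambda>g. f0 (g \<otimes> x))" if x: "x \<in> carrier G" for x
  proof -
    have w: "positive_measure [(1, x)]" using x by (simp add: positive_measure_def)
    have c: "snd ` set (convolution m [(1, x)]) \<subseteq> carrier G" by (rule conv_carrier[OF w])
    have "0 \<le> L (gap [(1, x)])" using w by (intro LD) (auto simp: D_def)
    also have "\<dots> = L (integ (convolution m [(1, x)])) + L (\<lambda>f. - (3/4 * b * integ [(1, x)] (\<lambda>_. 1)))"
      unfolding gap_eq by (rule mean_on_add[OF L int_bdd[OF c] const])
    also have "L (\<lambda>f. - (3/4 * b * integ [(1, x)] (\<lambda>_. 1))) \<le> - (3/4 * b)"
      by (intro mean_on_upper[OF L const]) simp
    also have "L (integ (convolution m [(1, x)])) = integ (convolution m [(1, x)]) f0"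
      unfolding f0_def by (rule mean_of_integ[OF L c])
    finally show ?thesis by (simp add: integ_convolution)
  qed
  define A where "A = {x \<in> carrier G. f0 x \<ge> 1/2}"
  define k where "k = (\<lambda>x. 2 * f0 x - indicator A x)"
  have HA: "H <#> A = A"
  proof
    show "H <#> A \<subseteq> A"
      using f0 HG by (auto simp: set_mult_def A_def invariant_functions_def subset_iff)
    show "A \<subseteq> H <#> A"
    proof
      fix x assume "x \<in> A"
      moreover from this have "\<one> \<otimes> x = x" by (simp add: A_def)
      moreover have "\<one> \<in> H" using H by (rule subgroup.one_closed)
      ultimately show "x \<in> H <#> A" unfolding set_mult_def by force
    qed
  qed
  have k: "k \<in> ?X"
    using f0 HG by (auto simp: invariant_functions_def k_def A_def indicator_def subset_iff)
  have "b/2 \<le> integ m (\<lambda>g. indicator A (g \<otimes> x))" if x: "x \<in> carrier G" for x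
  proof -
    have "integ m (\<lambda>g. k (g \<otimes> x)) \<le> b"
      by (intro bound invariant_functions_right_translate k HG x)
    moreover have "integ m (\<lambda>g. k (g \<otimes> x))
        = 2 * integ m (\<lambda>g. f0 (g \<otimes> x)) - integ m (\<lambda>g. indicator A (g \<otimes> x))"
      by (simp add: k_def integ_diff integ_scale)
    ultimately show ?thesis using f0_ge[OF x] by simp
  qed
  moreover have "A \<subseteq> carrier G" by (auto simp: A_def)
  ultimately have "b/2 \<le> 0" using folner_on_sets_average[OF fol _ HA m] by blast
  then show False using b by simp
qed

text \<open>The hypotheses of \<open>contraction_step\<close> are inherited by \<open>convolution m v\<close>, so its factor can be
  gained repeatedly.\<close>

lemma contraction_iterated:
  assumes H: "subgroup H G" and fol: "folner_on_sets H"
    and m: "snd ` set m \<subseteq> carrier G" "integ m (\<lambda>_. 1) = 0"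
    and b: "b > 0" and bound: "\<And>f. f \<in> invariant_functions H \<Longrightarrow> integ m f \<le> b"
  shows "\<exists>w. probability w \<and>
    (\<forall>f\<in>invariant_functions H. integ (convolution m w) f \<le> (3/4) ^ n * b)"
proof (induction n)
  case 0
  have "probability [(1, \<one>)]" by (simp add: probability_def positive_measure_def)
  moreover have "integ (convolution m [(1, \<one>)]) f = integ m f" for f
    using m by (auto simp: integ_convolution intro!: integ_cong)
  ultimately show ?case using bound by (intro exI[of _ "[(1, \<one>)]"]) simp
next
  case (Suc n)
  then obtain v where v: "probability v"
    "\<And>f. f \<in> invariant_functions H \<Longrightarrow> integ (convolution m v) f \<le> (3/4) ^ n * b" by blast
  have carr: "snd ` set v \<subseteq> carrier G" using v by (simp add: probability_def positive_measure_def)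
  obtain w where w: "probability w"
    "\<And>f. f \<in> invariant_functions H \<Longrightarrow>
       integ (convolution (convolution m v) w) f \<le> 3/4 * ((3/4) ^ n * b)"
  proof (rule contraction_step[OF H fol, of "convolution m v" "(3/4) ^ n * b"])
    show "snd ` set (convolution m v) \<subseteq> carrier G" by (rule convolution_carrier[OF m(1) carr])
    show "integ (convolution m v) (\<lambda>_. 1) = 0"
      using v(1) m(2) by (simp add: integ_convolution probability_def)
  qed (use v b in auto)
  have "integ (convolution m (convolution v w)) f = integ (convolution (convolution m v) w) f" for f
    unfolding integ_convolution
    using m(1) carr w(1)
    by (intro integ_cong) (auto simp: m_assoc subset_iff probability_def positive_measure_def)
  then show ?case
    using w probability_convolution[OF v(1) w(1)] by (intro exI[of _ "convolution v w"]) (simp add: mult.assoc)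
qed

text \<open>For \<open>m = \<delta>\<^sub>g - \<delta>\<^sub>1\<close> this is Reiter's condition on \<open>H \ G\<close> for one element \<open>g\<close>. The lower bound on
  the integrals comes from the invariant function \<open>1 - f\<close>, because \<open>m\<close> has total mass \<open>0\<close>.\<close>

lemma reiter_on_invariant_functions:
  assumes H: "subgroup H G" and fol: "folner_on_sets H"
    and m: "snd ` set m \<subseteq> carrier G" "integ m (\<lambda>_. 1) = 0" and e: "e > 0"
  obtains w where "probability w"
    and "\<And>f. f \<in> invariant_functions H \<Longrightarrow> \<bar>integ (convolution m w) f\<bar> \<le> e"
proof -
  define b where "b = total_variation m + 1"
  have b: "b > 0" using total_variation_nonneg[of m] by (simp add: b_def)
  have bound: "integ m f \<le> b" if f: "f \<in> invariant_functions H" for f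
  proof -
    have "\<bar>f x\<bar> \<le> 1" if "x \<in> carrier G" for x using f that by (auto simp: invariant_functions_def)
    then have "\<bar>integ m f\<bar> \<le> 1 * total_variation m" using m(1) by (intro abs_integ_le) blast
    then show ?thesis by (simp add: b_def)
  qed
  obtain n where "(3/4 :: real) ^ n < e / b"
    using real_arch_pow_inv[of "e / b" "3/4"] b e by auto
  then have n: "(3/4) ^ n * b \<le> e" using b by (simp add: field_simps)
  obtain w where w: "probability w"
    "\<And>f. f \<in> invariant_functions H \<Longrightarrow> integ (convolution m w) f \<le> (3/4) ^ n * b"
    using contraction_iterated[OF H fol m b bound] by blast
  show thesis
  proof (rule that[OF w(1)])
    fix f assume f: "f \<in> invariant_functions H"
    have "(\<lambda>x. 1 - f x) \<in> invariant_functions H" using f by (auto simp: invariant_functions_def)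
    then have "integ (convolution m w) (\<lambda>x. 1 - f x) \<le> e" using w(2) n by fastforce
    moreover have "integ (convolution m w) (\<lambda>_. 1) = 0"
      using w(1) m(2) by (simp add: integ_convolution probability_def)
    ultimately have "- integ (convolution m w) f \<le> e" by (simp add: integ_diff)
    moreover have "integ (convolution m w) f \<le> e" using w(2)[OF f] n by simp
    ultimately show "\<bar>integ (convolution m w) f\<bar> \<le> e" by simp
  qed
qed

end

section \<open>From the Folner condition on sets to amenability\<close>

context group
begin

text \<open>Choose a representative in every coset of \<open>H\<close> and rescale to the unit interval.\<close>

lemma approx_by_invariant_function:
  assumes H: "subgroup H G" and M: "M > 0" "\<And>x. x \<in> carrier G \<Longrightarrow> \<bar>f x\<bar> \<le> M"
    and near: "\<And>h x. h \<in> H \<Longrightarrow> x \<in> carrier G \<Longrightarrow> \<bar>f (h \<otimes> x) - f x\<bar> \<le> \<delta>"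
  obtains k where "k \<in> invariant_functions H"
    and "\<And>x. x \<in> carrier G \<Longrightarrow> \<bar>f x - (2 * M * k x - M)\<bar> \<le> \<delta>"
proof
  have HG: "H \<subseteq> carrier G" using H by (rule subgroup.subset)
  define rep where "rep = (\<lambda>x. SOME y. y \<in> H #> x)"
  have rep: "\<exists>h\<in>H. rep x = h \<otimes> x" if x: "x \<in> carrier G" for x
  proof -
    have "x \<in> H #> x" using rcos_self[OF x H] .
    then have "rep x \<in> H #> x" unfolding rep_def by (rule someI)
    then show ?thesis by (auto simp: r_coset_def)
  qed
  have rep_eq: "rep (h \<otimes> x) = rep x" if "h \<in> H" "x \<in> carrier G" for h x
  proof -
    have "H #> (h \<otimes> x) = (H #> h) #> x"
      using that HG by (intro coset_mult_assoc[symmetric]) auto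
    also have "H #> h = H" using that HG H by (intro coset_join2) auto
    finally show ?thesis by (simp add: rep_def)
  qed
  let ?k = "\<lambda>x. (f (rep x) + M) / (2 * M)"
  have "\<bar>f (rep x)\<bar> \<le> M" if "x \<in> carrier G" for x
  proof -
    have "rep x \<in> carrier G" using rep[OF that] that HG by auto
    then show ?thesis by (rule M(2))
  qed
  then have "0 \<le> f (rep x) + M \<and> f (rep x) \<le> M" if "x \<in> carrier G" for x
    using that by fastforce
  then show "?k \<in> invariant_functions H"
    using M(1) rep_eq by (auto simp: invariant_functions_def)
  show "\<bar>f x - (2 * M * ?k x - M)\<bar> \<le> \<delta>" if x: "x \<in> carrier G" for x
    using rep[OF x] near[OF _ x] M(1) by (auto simp: abs_minus_commute)
qed

end

context topological_group
begin

lemma UC_b_bounded: "f \<in> UC_b G T \<Longrightarrow> f \<in> bounded_functions (carrier G)"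
  by (simp add: UC_b_def bounded_functions_def)

lemma UC_b_almost_invariant:
  assumes "non_archimedean G T" "f \<in> UC_b G T" "\<delta> > 0"
  obtains H where "open_subgroup G T H"
    and "\<And>h x. h \<in> H \<Longrightarrow> x \<in> carrier G \<Longrightarrow> \<bar>f (h \<otimes> x) - f x\<bar> \<le> \<delta>"
proof -
  obtain U where U: "one_nbhd G T U"
    "\<And>x y. x \<in> carrier G \<Longrightarrow> y \<in> carrier G \<Longrightarrow> x \<otimes> inv y \<in> U \<Longrightarrow> \<bar>f x - f y\<bar> \<le> \<delta>"
    using assms(2,3) unfolding UC_b_def right_uniformly_continuous_def by blast
  obtain H where H: "open_subgroup G T H" "H \<subseteq> U"
    using assms(1) U(1) unfolding non_archimedean_def by blast
  show thesis
  proof (rule that[OF H(1)])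
    fix h x assume hx: "h \<in> H" "x \<in> carrier G"
    then have h: "h \<in> carrier G" using H(1) subgroup.subset by (auto simp: open_subgroup_def)
    have "(h \<otimes> x) \<otimes> inv x = h" using hx h by (simp add: m_assoc)
    then show "\<bar>f (h \<otimes> x) - f x\<bar> \<le> \<delta>" using U(2)[of "h \<otimes> x" x] hx h H(2) by auto
  qed
qed

lemma UC_b_scale:
  assumes "f \<in> UC_b G T"
  shows "(\<lambda>x\<in>carrier G. c * f x) \<in> UC_b G T"
proof -
  have "right_uniformly_continuous G T (\<lambda>x\<in>carrier G. c * f x)"
    unfolding right_uniformly_continuous_def
  proof (intro allI impI)
    fix e :: real assume e: "e > 0"
    then have "e / (\<bar>c\<bar> + 1) > 0" by simp
    then obtain U where U: "one_nbhd G T U"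
      "\<forall>x\<in>carrier G. \<forall>y\<in>carrier G. x \<otimes> inv y \<in> U \<longrightarrow> \<bar>f x - f y\<bar> \<le> e / (\<bar>c\<bar> + 1)"
      using assms unfolding UC_b_def right_uniformly_continuous_def by blast
    have le: "\<bar>c * f x - c * f y\<bar> \<le> e" if "\<bar>f x - f y\<bar> \<le> e / (\<bar>c\<bar> + 1)" for x y
    proof -
      have "\<bar>c * f x - c * f y\<bar> = \<bar>c\<bar> * \<bar>f x - f y\<bar>" by (simp add: abs_mult flip: right_diff_distrib)
      also have "\<dots> \<le> (\<bar>c\<bar> + 1) * (e / (\<bar>c\<bar> + 1))" using that by (intro mult_mono) auto
      finally show ?thesis by (simp add: add_pos_nonneg)
    qed
    show "\<exists>U. one_nbhd G T U \<and> (\<forall>x\<in>carrier G. \<forall>y\<in>carrier G. x \<otimes> inv y \<in> U \<longrightarrow>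
        \<bar>(\<lambda>x\<in>carrier G. c * f x) x - (\<lambda>x\<in>carrier G. c * f x) y\<bar> \<le> e)"
      using U le by (intro exI[of _ U]) auto
  qed
  moreover have "(\<lambda>x\<in>carrier G. c * f x) ` carrier G = (\<lambda>x. c * f x) ` carrier G" by auto
  then have "bounded ((\<lambda>x\<in>carrier G. c * f x) ` carrier G)"
    using function_space_scale[OF function_space_bounded_functions UC_b_bounded[OF assms]]
    by (simp add: bounded_functions_def)
  ultimately show ?thesis by (simp add: UC_b_def)
qed

text \<open>The pairs are treated one after the other. If \<open>v\<close> already serves the earlier pairs,
  \<open>reiter_on_invariant_functions\<close> applied to \<open>(\<delta>\<^sub>g - \<delta>\<^sub>1) v\<close> gives \<open>w\<close> such that \<open>v w\<close> serves the new
  pair; it still serves the earlier ones, since it averages right translates of \<open>v\<close>. The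
  quantification over \<open>y\<close> makes the statement stable under such averages.\<close>

lemma almost_invariant_probability:
  assumes na: "non_archimedean G T"
    and fol: "\<And>H. open_subgroup G T H \<Longrightarrow> folner_on_sets H"
    and fs: "\<And>f g. (f, g) \<in> set fs \<Longrightarrow> f \<in> UC_b G T \<and> g \<in> carrier G" and e: "e > 0"
  shows "\<exists>w. probability w \<and> (\<forall>(f, g)\<in>set fs. \<forall>y\<in>carrier G.
    \<bar>integ w (\<lambda>x. f (g \<otimes> x \<otimes> y) - f (x \<otimes> y))\<bar> \<le> e)"
  using fs
proof (induction fs)
  case Nil
  have "probability [(1, \<one>)]" by (simp add: probability_def positive_measure_def)
  then show ?case by auto
next
  case (Cons p fs)
  obtain f g where p: "p = (f, g)" by (cases p)
  have f: "f \<in> UC_b G T" and g: "g \<in> carrier G" using Cons.prems p by auto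
  obtain v where v: "probability v" and v_inv: "\<And>f g y. (f, g) \<in> set fs \<Longrightarrow> y \<in> carrier G \<Longrightarrow>
    \<bar>integ v (\<lambda>x. f (g \<otimes> x \<otimes> y) - f (x \<otimes> y))\<bar> \<le> e"
    using Cons by fastforce
  obtain M where M: "M > 0" "\<And>x. x \<in> carrier G \<Longrightarrow> \<bar>f x\<bar> \<le> M"
    using UC_b_bounded[OF f] by (metis bounded_functionsE)
  obtain H where H: "open_subgroup G T H"
    "\<And>h x. h \<in> H \<Longrightarrow> x \<in> carrier G \<Longrightarrow> \<bar>f (h \<otimes> x) - f x\<bar> \<le> e / 4"
    using UC_b_almost_invariant[OF na f, of "e / 4"] e by auto
  have sub: "subgroup H G" and HG: "H \<subseteq> carrier G"
    using H(1) by (auto simp: open_subgroup_def subgroup.subset)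
  obtain k where k: "k \<in> invariant_functions H"
    "\<And>x. x \<in> carrier G \<Longrightarrow> \<bar>f x - (2 * M * k x - M)\<bar> \<le> e / 4"
    using approx_by_invariant_function[OF sub M H(2)] by blast
  have carr: "snd ` set v \<subseteq> carrier G" using v by (simp add: probability_def positive_measure_def)
  \<comment> \<open>The measure \<open>(\<delta>\<^sub>g - \<delta>\<^sub>1) v\<close>.\<close>
  let ?m = "convolution [(1, g), (-1, \<one>)] v"
  obtain w where w: "probability w"
    "\<And>f. f \<in> invariant_functions H \<Longrightarrow> \<bar>integ (convolution ?m w) f\<bar> \<le> e / (4 * M)"
  proof (rule reiter_on_invariant_functions[OF sub fol[OF H(1)], of ?m "e / (4 * M)"])
    show "snd ` set ?m \<subseteq> carrier G" using g carr by (intro convolution_carrier) auto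
    show "integ ?m (\<lambda>_. 1) = 0" by (simp add: integ_convolution)
  qed (use e M in auto)
  have wcarr: "snd ` set w \<subseteq> carrier G" using w by (simp add: probability_def positive_measure_def)
  let ?w = "convolution v w"
  have pw: "probability ?w" by (rule probability_convolution[OF v w(1)])
  then have pwcarr: "snd ` set ?w \<subseteq> carrier G" by (simp add: probability_def positive_measure_def)
  have m_eq: "integ (convolution ?m w) F = integ ?w (\<lambda>x. F (g \<otimes> x) - F x)" for F
  proof -
    have "integ (convolution ?m w) F =
        integ v (\<lambda>a. integ w (\<lambda>x. F (g \<otimes> a \<otimes> x))) - integ v (\<lambda>a. integ w (\<lambda>x. F (\<one> \<otimes> a \<otimes> x)))"
      by (simp add: integ_convolution)
    also have "integ v (\<lambda>a. integ w (\<lambda>x. F (g \<otimes> a \<otimes> x))) = integ v (\<lambda>a. integ w (\<lambda>x. F (g \<otimes> (a \<otimes> x))))"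
      using carr wcarr g by (intro integ_cong) (auto simp: m_assoc subset_iff)
    also have "integ v (\<lambda>a. integ w (\<lambda>x. F (\<one> \<otimes> a \<otimes> x))) = integ v (\<lambda>a. integ w (\<lambda>x. F (a \<otimes> x)))"
      using carr by (intro integ_cong) (auto simp: subset_iff)
    finally show ?thesis by (simp add: integ_convolution integ_diff)
  qed
  have new: "\<bar>integ ?w (\<lambda>x. f (g \<otimes> x \<otimes> y) - f (x \<otimes> y))\<bar> \<le> e" if y: "y \<in> carrier G" for y
  proof -
    let ?r = "\<lambda>x. f x - (2 * M * k x - M)"
    have "\<bar>integ ?w (\<lambda>x. k (g \<otimes> x \<otimes> y) - k (x \<otimes> y))\<bar> \<le> e / (4 * M)"
      using w(2)[OF invariant_functions_right_translate[OF k(1) HG y]] unfolding m_eq .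
    then have "2 * M * \<bar>integ ?w (\<lambda>x. k (g \<otimes> x \<otimes> y) - k (x \<otimes> y))\<bar> \<le> e / 2"
      using M(1) by (simp add: field_simps)
    then have "\<bar>integ ?w (\<lambda>x. 2 * M * (k (g \<otimes> x \<otimes> y) - k (x \<otimes> y)))\<bar> \<le> e / 2"
      using M(1) unfolding integ_scale by (simp add: abs_mult)
    moreover have "\<bar>integ ?w (\<lambda>x. ?r (g \<otimes> x \<otimes> y))\<bar> \<le> e / 4"
      using k(2) g y by (intro abs_integ_probability_le[OF pw]) auto
    moreover have "\<bar>integ ?w (\<lambda>x. ?r (x \<otimes> y))\<bar> \<le> e / 4"
      using k(2) y by (intro abs_integ_probability_le[OF pw]) auto
    moreover have "integ ?w (\<lambda>x. f (g \<otimes> x \<otimes> y) - f (x \<otimes> y)) =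
        integ ?w (\<lambda>x. 2 * M * (k (g \<otimes> x \<otimes> y) - k (x \<otimes> y)))
        + (integ ?w (\<lambda>x. ?r (g \<otimes> x \<otimes> y)) - integ ?w (\<lambda>x. ?r (x \<otimes> y)))"
      unfolding integ_add[symmetric] integ_diff[symmetric] by (simp add: algebra_simps)
    ultimately show ?thesis by linarith
  qed
  have old: "\<bar>integ ?w (\<lambda>x. f' (g' \<otimes> x \<otimes> y) - f' (x \<otimes> y))\<bar> \<le> e"
    if fg: "(f', g') \<in> set fs" and y: "y \<in> carrier G" for f' g' y
  proof -
    have g': "g' \<in> carrier G" using Cons.prems fg by auto
    have "integ ?w (\<lambda>x. f' (g' \<otimes> x \<otimes> y) - f' (x \<otimes> y))
        = integ w (\<lambda>x. integ v (\<lambda>a. f' (g' \<otimes> (a \<otimes> x) \<otimes> y) - f' (a \<otimes> x \<otimes> y)))"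
      unfolding integ_convolution by (rule integ_swap)
    also have "\<dots> = integ w (\<lambda>x. integ v (\<lambda>a. f' (g' \<otimes> a \<otimes> (x \<otimes> y)) - f' (a \<otimes> (x \<otimes> y))))"
      using carr wcarr g' y by (intro integ_cong) (auto simp: m_assoc subset_iff)
    also have "\<bar>\<dots>\<bar> \<le> e"
      using v_inv[OF fg] y by (intro abs_integ_probability_le[OF w(1)]) auto
    finally show ?thesis .
  qed
  show ?case
    using pw new old by (intro exI[of _ ?w]) (auto simp: p)
qed

text \<open>For lists over \<open>UC_b G T\<close> these sums form the span of the functions \<open>f \<circ> \<lambda>\<^sub>g - f\<close>, on which an
  invariant mean has to vanish; scalars are absorbed into \<open>f\<close>.\<close>

definition defect :: "(('a \<Rightarrow> real) \<times> 'a) list \<Rightarrow> 'a \<Rightarrow> real" where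
  "defect fs x = (\<Sum>(f, g)\<leftarrow>fs. f (g \<otimes> x) - f x)"

lemma defect_Nil [simp]: "defect [] x = 0"
  and defect_Cons [simp]: "defect ((f, g) # fs) x = (f (g \<otimes> x) - f x) + defect fs x"
  and defect_append [simp]: "defect (fs @ fs') x = defect fs x + defect fs' x"
  by (simp_all add: defect_def)

text \<open>The measures of \<open>almost_invariant_probability\<close> show that no element of the span of the functions
  \<open>f \<circ> \<lambda>\<^sub>g - f\<close> is bounded above by a negative constant. Hence \<open>mean_nonneg_on_cone\<close> gives a mean
  that is nonnegative on this span, and therefore zero on it.\<close>

lemma folner_imp_amenable:
  assumes na: "non_archimedean G T"
    and fol: "\<And>H. open_subgroup G T H \<Longrightarrow> folner_on_sets H"
  shows "amenable G T"
proof -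
  let ?B = "bounded_functions (carrier G)"
  note S = function_space_bounded_functions[of "carrier G"]
  define Lists where "Lists = {fs. \<forall>(f, g)\<in>set fs. f \<in> UC_b G T \<and> g \<in> carrier G}"
  define D where "D = {d \<in> ?B. \<exists>fs\<in>Lists. \<forall>x\<in>carrier G. d x = defect fs x}"
  obtain L where L: "mean_on (carrier G) L" and LD: "\<And>d. d \<in> D \<Longrightarrow> 0 \<le> L d"
  proof (rule mean_nonneg_on_cone[of "carrier G" D])
    show "carrier G \<noteq> {}" by auto
    show "D \<subseteq> ?B" by (auto simp: D_def)
    have "(\<lambda>x. 0) \<in> D"
      unfolding D_def by (auto simp: Lists_def intro!: exI[of _ "[]"] bounded_functionsI[of _ _ 0])
    then show "D \<noteq> {}" by blast
    show "(\<lambda>x. d x + e x) \<in> D" if "d \<in> D" "e \<in> D" for d e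
    proof -
      obtain fs fs' where fs: "fs \<in> Lists" "\<forall>x\<in>carrier G. d x = defect fs x"
        and fs': "fs' \<in> Lists" "\<forall>x\<in>carrier G. e x = defect fs' x"
        using \<open>d \<in> D\<close> \<open>e \<in> D\<close> by (auto simp: D_def)
      have "fs @ fs' \<in> Lists" using fs fs' by (auto simp: Lists_def)
      then show ?thesis
        using that fs fs' function_space_add[OF S, of d e]
        unfolding D_def by (auto intro!: bexI[of _ "fs @ fs'"])
    qed
    show "(\<lambda>x. c * d x) \<in> D" if "d \<in> D" "c \<ge> 0" for d c
    proof -
      obtain fs where fs: "fs \<in> Lists" "\<forall>x\<in>carrier G. d x = defect fs x"
        using \<open>d \<in> D\<close> by (auto simp: D_def)
      let ?fs = "map (\<lambda>(f, g). (\<lambda>x\<in>carrier G. c * f x, g)) fs"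
      have "?fs \<in> Lists" using fs(1) UC_b_scale by (fastforce simp: Lists_def)
      moreover have "c * defect fs x = defect ?fs x" if "x \<in> carrier G" for x
        using fs(1) that by (induction fs) (auto simp: Lists_def algebra_simps)
      ultimately show ?thesis
        using that fs function_space_scale[OF S, of d c]
        unfolding D_def by (auto intro!: bexI[of _ ?fs])
    qed
    show "\<exists>x\<in>carrier G. - e \<le> d x" if d: "d \<in> D" and e: "e > 0" for d e
    proof (rule ccontr)
      assume "\<not> ?thesis"
      then have neg: "d x \<le> - e" if "x \<in> carrier G" for x using that by (meson linear)
      obtain fs where fs: "fs \<in> Lists" "\<forall>x\<in>carrier G. d x = defect fs x"
        using d by (auto simp: D_def)
      \<comment> \<open>The \<open>length fs\<close> summands of the defect together stay below \<open>e\<close>.\<close>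
      define \<delta> where "\<delta> = e / (real (length fs) + 1)"
      have \<delta>: "\<delta> > 0" using e by (simp add: \<delta>_def add_nonneg_pos)
      obtain w where w: "probability w" and w_inv: "\<And>f g y. (f, g) \<in> set fs \<Longrightarrow> y \<in> carrier G \<Longrightarrow>
          \<bar>integ w (\<lambda>x. f (g \<otimes> x \<otimes> y) - f (x \<otimes> y))\<bar> \<le> \<delta>"
        using almost_invariant_probability[OF na fol _ \<delta>, of fs] fs(1) by (fastforce simp: Lists_def)
      have wcarr: "snd ` set w \<subseteq> carrier G" using w by (simp add: probability_def positive_measure_def)
      have w_inv1: "\<bar>integ w (\<lambda>x. f (g \<otimes> x) - f x)\<bar> \<le> \<delta>" if fg: "(f, g) \<in> set fs" for f g
      proof -
        have "g \<in> carrier G" using fs(1) fg by (auto simp: Lists_def)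
        then have "integ w (\<lambda>x. f (g \<otimes> x \<otimes> \<one>) - f (x \<otimes> \<one>)) = integ w (\<lambda>x. f (g \<otimes> x) - f x)"
          using wcarr by (intro integ_cong) (auto simp: subset_iff)
        then show ?thesis using w_inv[OF fg, of \<one>] by simp
      qed
      have "\<bar>integ w (defect gs)\<bar> \<le> real (length gs) * \<delta>" if "set gs \<subseteq> set fs" for gs
        using that
      proof (induction gs)
        case Nil
        have "defect [] = (\<lambda>x. 0)" by auto
        then show ?case by simp
      next
        case (Cons q gs)
        obtain f g where q: "q = (f, g)" by (cases q)
        have "defect (q # gs) = (\<lambda>x. (f (g \<otimes> x) - f x) + defect gs x)" by (auto simp: q)
        then have "integ w (defect (q # gs)) = integ w (\<lambda>x. f (g \<otimes> x) - f x) + integ w (defect gs)"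
          by (simp only: integ_add)
        moreover have "\<bar>integ w (\<lambda>x. f (g \<otimes> x) - f x)\<bar> \<le> \<delta>"
          using Cons.prems q by (intro w_inv1) simp
        ultimately show ?case using Cons by (simp add: algebra_simps)
      qed
      from this[of fs] have "\<bar>integ w (defect fs)\<bar> \<le> real (length fs) * \<delta>" by simp
      also have "\<dots> < e" using e by (simp add: \<delta>_def field_simps)
      finally have "\<bar>integ w (defect fs)\<bar> < e" .
      moreover have "integ w (defect fs) \<le> - e"
        using neg fs(2) by (intro integ_probability_le[OF w]) auto
      ultimately show False by simp
    qed
  qed blast
  have bdd: "f ` carrier G \<noteq> {}" "bdd_below (f ` carrier G)" "bdd_above (f ` carrier G)"
    if "f \<in> UC_b G T" for f
    using that by (auto simp: UC_b_def bounded_imp_bdd_below bounded_imp_bdd_above)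
  have restr: "L (restrict k (carrier G)) = L k" if "k \<in> ?B" for k
    using that by (intro mean_on_cong[OF L]) (auto simp: bounded_functions_def image_def)
  have transl: "(\<lambda>x. f (g \<otimes> x)) \<in> ?B" if f: "f \<in> ?B" and g: "g \<in> carrier G" for f g
  proof -
    obtain b where "\<And>x. x \<in> carrier G \<Longrightarrow> \<bar>f x\<bar> \<le> b" using f by (metis bounded_functionsE)
    then show ?thesis using g by (intro bounded_functionsI[of _ _ b]) auto
  qed
  have le: "L f \<le> L (\<lambda>x. f (g \<otimes> x))" if f: "f \<in> UC_b G T" and g: "g \<in> carrier G" for f g
  proof -
    note fB = UC_b_bounded[OF f]
    have m: "(\<lambda>x. -1 * f x) \<in> ?B" by (rule function_space_scale[OF S fB])
    have "(\<lambda>x. f (g \<otimes> x) + -1 * f x) \<in> D"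
      using f g function_space_add[OF S transl[OF fB g] m] unfolding D_def
      by (auto simp: Lists_def intro!: exI[of _ "[(f, g)]"])
    then have "0 \<le> L (\<lambda>x. f (g \<otimes> x) + -1 * f x)" by (rule LD)
    then show ?thesis
      using mean_on_add[OF L transl[OF fB g] m] mean_on_scale[OF L fB, of "-1"] by simp
  qed
  have inv: "L (\<lambda>x. f (g \<otimes> x)) = L f" if f: "f \<in> UC_b G T" and g: "g \<in> carrier G" for f g
  proof (rule order_antisym[OF _ le[OF f g]])
    note fB = UC_b_bounded[OF f]
    let ?h = "\<lambda>x\<in>carrier G. -1 * f x"
    have h: "?h \<in> UC_b G T" by (rule UC_b_scale[OF f])
    have "L ?h \<le> L (\<lambda>x. ?h (g \<otimes> x))" by (rule le[OF h g])
    also have "L (\<lambda>x. ?h (g \<otimes> x)) = L (\<lambda>x. -1 * f (g \<otimes> x))"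
      using g by (intro mean_on_cong[OF L transl[OF UC_b_bounded[OF h] g]]
        function_space_scale[OF S] transl[OF fB g]) auto
    also have "\<dots> = -1 * L (\<lambda>x. f (g \<otimes> x))" by (rule mean_on_scale[OF L transl[OF fB g]])
    also have "L ?h = -1 * L f"
      using restr[OF function_space_scale[OF S fB, of "-1"]] mean_on_scale[OF L fB, of "-1"] by simp
    finally show "L (\<lambda>x. f (g \<otimes> x)) \<le> L f" by simp
  qed
  have "mean G T L"
    unfolding mean_def
  proof (intro conjI ballI allI)
    fix f h assume "f \<in> UC_b G T" "h \<in> UC_b G T"
    note * = this[THEN UC_b_bounded]
    show "L (\<lambda>x\<in>carrier G. f x + h x) = L f + L h"
      using restr[OF function_space_add[OF S *]] mean_on_add[OF L *] by simp
  next
    fix c f assume "f \<in> UC_b G T"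
    note * = this[THEN UC_b_bounded]
    show "L (\<lambda>x\<in>carrier G. c * f x) = c * L f"
      using restr[OF function_space_scale[OF S *]] mean_on_scale[OF L *] by simp
  next
    fix f assume f: "f \<in> UC_b G T"
    show "(INF x\<in>carrier G. f x) \<le> L f"
      by (intro mean_on_lower[OF L UC_b_bounded[OF f]] cINF_lower bdd(2)[OF f])
    show "L f \<le> (SUP x\<in>carrier G. f x)"
      by (intro mean_on_upper[OF L UC_b_bounded[OF f]] cSUP_upper bdd(3)[OF f])
  qed
  moreover have "L (restrict (f \<circ> left_transl G g) (carrier G)) = L f"
    if "f \<in> UC_b G T" "g \<in> carrier G" for f g
    using restr[OF transl[OF UC_b_bounded[OF that(1)] that(2)]] inv[OF that]
    by (simp add: comp_def left_transl_def)
  ultimately show ?thesis unfolding amenable_def by blast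
qed

end

section \<open>From amenability to the Folner condition on colourings\<close>

text \<open>Take about \<open>N \<cdot> p j\<close> points of colour \<open>j\<close> for a large \<open>N\<close>. A set, rather than a multiset, can be
  found because colours of positive mass occur infinitely often.\<close>

lemma proportional_selection:
  fixes c :: "'x \<Rightarrow> 'j" and p :: "'j \<Rightarrow> real"
  assumes J: "finite J" and p: "\<And>j. j \<in> J \<Longrightarrow> p j \<ge> 0" "(\<Sum>j\<in>J. p j) = 1"
    and inf: "\<And>j. j \<in> J \<Longrightarrow> p j > 0 \<Longrightarrow> infinite {x\<in>X. c x = j}" and e: "e > 0"
  obtains F where "F \<subseteq> X" "finite F" "F \<noteq> {}" "c ` F \<subseteq> J"
    and "\<And>I. I \<subseteq> J \<Longrightarrow> \<bar>real (card {x\<in>F. c x \<in> I}) - real (card F) * (\<Sum>j\<in>I. p j)\<bar> \<le> e * real (card F)"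
proof -
  define q where "q = real (card J)"
  \<comment> \<open>Rounding costs at most \<open>q\<close> in the number of points of \<open>F\<close>, and \<open>2 q\<close> in every deviation;
      the summand \<open>1\<close> makes \<open>F\<close> nonempty.\<close>
  define N where "N = q + 2 * q / e + 1"
  have q: "q \<ge> 0" by (simp add: q_def)
  have N: "N > 0" using q e by (simp add: N_def add_nonneg_pos)
  define k where "k = (\<lambda>j. nat \<lfloor>N * p j\<rfloor>)"
  have k: "real (k j) \<le> N * p j" "N * p j - 1 \<le> real (k j)" if "j \<in> J" for j
    using p(1)[OF that] N by (simp_all add: k_def) 
  have "\<exists>S. S \<subseteq> {x\<in>X. c x = j} \<and> finite S \<and> card S = k j" if j: "j \<in> J" for j
  proof (cases "p j > 0")
    case True
    then show ?thesis using infinite_arbitrarily_large[OF inf[OF j], of "k j"] by blast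
  next
    case False
    then have "k j = 0" using p(1)[OF j] by (simp add: k_def)
    then show ?thesis by (intro exI[of _ "{}"]) simp
  qed
  then obtain S where S: "\<And>j. j \<in> J \<Longrightarrow> S j \<subseteq> {x\<in>X. c x = j}" "\<And>j. j \<in> J \<Longrightarrow> finite (S j)"
    "\<And>j. j \<in> J \<Longrightarrow> card (S j) = k j" by metis
  define F where "F = (\<Union>j\<in>J. S j)"
  have count: "card {x\<in>F. c x \<in> I} = (\<Sum>j\<in>I. k j)" if I: "I \<subseteq> J" for I
  proof -
    have "{x\<in>F. c x \<in> I} = (\<Union>j\<in>I. S j)" using S(1) I by (fastforce simp: F_def)
    also have "card \<dots> = (\<Sum>j\<in>I. card (S j))"
      using I J S(1,2) by (intro card_UN_disjoint) (auto intro: finite_subset, blast)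
    also have "\<dots> = (\<Sum>j\<in>I. k j)" using I S(3) by (intro sum.cong) auto
    finally show ?thesis .
  qed
  have cF: "c ` F \<subseteq> J" using S(1) by (force simp: F_def)
  then have "{x\<in>F. c x \<in> J} = F" by auto
  then have cardF: "card F = (\<Sum>j\<in>J. k j)" using count[of J] by simp
  have dev: "\<bar>real (\<Sum>j\<in>I. k j) - N * (\<Sum>j\<in>I. p j)\<bar> \<le> q" if I: "I \<subseteq> J" for I
  proof -
    have "\<bar>\<Sum>j\<in>I. real (k j) - N * p j\<bar> \<le> (\<Sum>j\<in>I. \<bar>real (k j) - N * p j\<bar>)" by (rule sum_abs)
    also have "\<dots> \<le> (\<Sum>j\<in>I. 1)" using k I by (intro sum_mono) (force simp: abs_le_iff)
    also have "\<dots> \<le> q" using I J by (simp add: q_def card_mono)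
    finally show ?thesis by (simp add: sum_subtractf sum_distrib_left)
  qed
  have n: "\<bar>real (card F) - N\<bar> \<le> q" using dev[of J] p(2) cardF by simp
  have large: "2 * q \<le> e * real (card F)" "card F > 0"
  proof -
    have "2 * q / e + 1 \<le> real (card F)" using n unfolding N_def by linarith
    then have "e * (2 * q / e + 1) \<le> e * real (card F)" using e by (intro mult_left_mono) auto
    then show "2 * q \<le> e * real (card F)" using e by (simp add: distrib_left)
    have "0 < 2 * q / e + 1" using q e by (simp add: add_nonneg_pos)
    then show "card F > 0" using \<open>2 * q / e + 1 \<le> real (card F)\<close> by linarith
  qed
  show thesis
  proof (rule that[OF _ _ _ cF])
    show "F \<subseteq> X" "finite F" using S J by (auto simp: F_def)
    show "F \<noteq> {}" using large(2) by auto
    fix I assume I: "I \<subseteq> J"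
    let ?s = "\<Sum>j\<in>I. p j"
    have "?s \<le> (\<Sum>j\<in>J. p j)" using p(1) I J by (intro sum_mono2) auto
    then have "?s \<le> 1" using p(2) by simp
    moreover have "0 \<le> ?s" using p I by (intro sum_nonneg) auto
    ultimately have "\<bar>(real (card F) - N) * ?s\<bar> \<le> q * 1"
      unfolding abs_mult using n q by (intro mult_mono) auto
    then have "\<bar>real (card F) * ?s - N * ?s\<bar> \<le> q" by (simp add: left_diff_distrib)
    then show "\<bar>real (card {x\<in>F. c x \<in> I}) - real (card F) * ?s\<bar> \<le> e * real (card F)"
      using dev[OF I] large(1) unfolding count[OF I] by linarith
  qed
qed

context topological_group
begin

lemma continuous_conjugation:
  assumes g: "g \<in> carrier G"
  shows "continuous_map T T (\<lambda>x. g \<otimes> x \<otimes> inv g)"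
proof -
  have mult: "continuous_map T T (\<lambda>x. a x \<otimes> b x)"
    if "continuous_map T T a" "continuous_map T T b" for a b
    using continuous_map_compose[OF continuous_map_pairedI[OF that] continuous_mult]
    by (simp add: comp_def)
  have const: "continuous_map T T (\<lambda>x. a)" if "a \<in> carrier G" for a
    using that topspace_eq_carrier by simp
  show ?thesis using g by (intro mult const continuous_map_id[unfolded id_def]) auto
qed

lemma one_nbhd_carrier: "one_nbhd G T (carrier G)"
  using topspace_eq_carrier openin_topspace[of T] by (auto simp: one_nbhd_def intro!: exI[of _ "topspace T"])

lemma one_nbhd_Int: "one_nbhd G T U \<Longrightarrow> one_nbhd G T V \<Longrightarrow> one_nbhd G T (U \<inter> V)"
  unfolding one_nbhd_def by (metis IntI Int_mono inf.coboundedI1 openin_Int)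

text \<open>For finitely many \<open>g\<close> this neighborhood controls left translation by all of them, since
  \<open>g x (g y)\<inverse> = g (x y\<inverse>) g\<inverse>\<close>.\<close>

lemma one_nbhd_conjugates:
  assumes "one_nbhd G T U" "finite E" "E \<subseteq> carrier G"
  shows "one_nbhd G T {u \<in> carrier G. \<forall>g\<in>E. g \<otimes> u \<otimes> inv g \<in> U}"
  using assms(2,3)
proof (induction E)
  case empty
  then show ?case using one_nbhd_carrier by simp
next
  case (insert g E)
  obtain V where V: "openin T V" "\<one> \<in> V" "V \<subseteq> U" using assms(1) by (auto simp: one_nbhd_def)
  have "openin T {u \<in> topspace T. g \<otimes> u \<otimes> inv g \<in> V}"
    using insert.prems V by (intro openin_continuous_map_preimage[OF continuous_conjugation]) auto
  then have "one_nbhd G T {u \<in> carrier G. g \<otimes> u \<otimes> inv g \<in> U}"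
    using V insert.prems unfolding one_nbhd_def topspace_eq_carrier
    by (intro conjI exI[of _ "{u \<in> carrier G. g \<otimes> u \<otimes> inv g \<in> V}"]) auto
  then have "one_nbhd G T ({u \<in> carrier G. g \<otimes> u \<otimes> inv g \<in> U} \<inter>
      {u \<in> carrier G. \<forall>g\<in>E. g \<otimes> u \<otimes> inv g \<in> U})"
    using insert by (intro one_nbhd_Int) auto
  moreover have "{u \<in> carrier G. g \<otimes> u \<otimes> inv g \<in> U} \<inter>
      {u \<in> carrier G. \<forall>g\<in>E. g \<otimes> u \<otimes> inv g \<in> U}
      = {u \<in> carrier G. \<forall>g\<in>insert g E. g \<otimes> u \<otimes> inv g \<in> U}" by auto
  ultimately show ?case by simp
qed

lemma UC_bI:
  assumes "\<And>x. x \<in> carrier G \<Longrightarrow> \<bar>f x\<bar> \<le> b"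
    and "\<And>e. e > 0 \<Longrightarrow> \<exists>U. one_nbhd G T U \<and> (\<forall>x\<in>carrier G. \<forall>y\<in>carrier G.
           x \<otimes> inv y \<in> U \<longrightarrow> \<bar>f x - f y\<bar> \<le> e)"
  shows "(\<lambda>x\<in>carrier G. f x) \<in> UC_b G T"
proof -
  have "(\<lambda>x\<in>carrier G. f x) ` carrier G = f ` carrier G" by auto
  moreover have "bounded (f ` carrier G)" using assms(1) by (auto simp: bounded_iff)
  ultimately show ?thesis
    using assms(2) by (auto simp: UC_b_def right_uniformly_continuous_def)
qed

lemma UC_b_add:
  assumes f: "f \<in> UC_b G T" and h: "h \<in> UC_b G T"
  shows "(\<lambda>x\<in>carrier G. f x + h x) \<in> UC_b G T"
proof -
  have "(\<lambda>x. f x + h x) \<in> bounded_functions (carrier G)"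
    by (intro function_space_add[OF function_space_bounded_functions] UC_b_bounded f h)
  then obtain b where b: "\<And>x. x \<in> carrier G \<Longrightarrow> \<bar>f x + h x\<bar> \<le> b"
    by (rule bounded_functionsE) (rule that)
  show ?thesis
  proof (rule UC_bI[OF b])
    fix e :: real assume "e > 0"
    then have e: "e / 2 > 0" by simp
    obtain U where U: "one_nbhd G T U"
      "\<forall>x\<in>carrier G. \<forall>y\<in>carrier G. x \<otimes> inv y \<in> U \<longrightarrow> \<bar>f x - f y\<bar> \<le> e / 2"
      using f e unfolding UC_b_def right_uniformly_continuous_def by blast
    obtain V where V: "one_nbhd G T V"
      "\<forall>x\<in>carrier G. \<forall>y\<in>carrier G. x \<otimes> inv y \<in> V \<longrightarrow> \<bar>h x - h y\<bar> \<le> e / 2"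
      using h e unfolding UC_b_def right_uniformly_continuous_def by blast
    have "\<bar>(f x + h x) - (f y + h y)\<bar> \<le> e"
      if "x \<in> carrier G" "y \<in> carrier G" "x \<otimes> inv y \<in> U \<inter> V" for x y
    proof -
      have "\<bar>f x - f y\<bar> \<le> e / 2" "\<bar>h x - h y\<bar> \<le> e / 2" using U(2) V(2) that by auto
      then show ?thesis by linarith
    qed
    then show "\<exists>U. one_nbhd G T U \<and> (\<forall>x\<in>carrier G. \<forall>y\<in>carrier G.
        x \<otimes> inv y \<in> U \<longrightarrow> \<bar>(f x + h x) - (f y + h y)\<bar> \<le> e)"
      using one_nbhd_Int[OF U(1) V(1)] by blast
  qed
qed

lemma UC_b_const: "(\<lambda>x\<in>carrier G. c) \<in> UC_b G T"
  using one_nbhd_carrier by (intro UC_bI[of _ "\<bar>c\<bar>"]) auto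

lemma UC_b_left_translate:
  assumes f: "f \<in> UC_b G T" and g: "g \<in> carrier G"
  shows "(\<lambda>x\<in>carrier G. f (g \<otimes> x)) \<in> UC_b G T"
proof -
  obtain b where b: "\<And>x. x \<in> carrier G \<Longrightarrow> \<bar>f x\<bar> \<le> b"
    using UC_b_bounded[OF f] by (metis bounded_functionsE)
  show ?thesis
  proof (rule UC_bI)
    show "\<bar>f (g \<otimes> x)\<bar> \<le> b" if "x \<in> carrier G" for x using b that g by simp
    fix e :: real assume "e > 0"
    then obtain U where U: "one_nbhd G T U"
      "\<forall>x\<in>carrier G. \<forall>y\<in>carrier G. x \<otimes> inv y \<in> U \<longrightarrow> \<bar>f x - f y\<bar> \<le> e"
      using f unfolding UC_b_def right_uniformly_continuous_def by blast
    let ?U = "{u \<in> carrier G. \<forall>g\<in>{g}. g \<otimes> u \<otimes> inv g \<in> U}"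
    have "one_nbhd G T ?U" using g by (intro one_nbhd_conjugates U) auto
    moreover have "\<bar>f (g \<otimes> x) - f (g \<otimes> y)\<bar> \<le> e"
      if "x \<in> carrier G" "y \<in> carrier G" "x \<otimes> inv y \<in> ?U" for x y
    proof -
      have "(g \<otimes> x) \<otimes> inv (g \<otimes> y) = g \<otimes> (x \<otimes> inv y) \<otimes> inv g"
        using that(1,2) g by (simp add: inv_mult_group m_assoc)
      then show ?thesis using U(2) that g by auto
    qed
    ultimately show "\<exists>U. one_nbhd G T U \<and> (\<forall>x\<in>carrier G. \<forall>y\<in>carrier G.
        x \<otimes> inv y \<in> U \<longrightarrow> \<bar>f (g \<otimes> x) - f (g \<otimes> y)\<bar> \<le> e)" by blast
  qed
qed

lemma mean_sum:
  assumes \<nu>: "mean G T \<nu>" and I: "finite I" and f: "\<And>i. i \<in> I \<Longrightarrow> f i \<in> UC_b G T"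
  shows "(\<lambda>x\<in>carrier G. \<Sum>i\<in>I. f i x) \<in> UC_b G T \<and>
    \<nu> (\<lambda>x\<in>carrier G. \<Sum>i\<in>I. f i x) = (\<Sum>i\<in>I. \<nu> (f i))"
  using I f
proof (induction I)
  case empty
  have "\<nu> (\<lambda>x\<in>carrier G. 0 * (\<lambda>x\<in>carrier G. 0) x) = 0 * \<nu> (\<lambda>x\<in>carrier G. 0)"
    using \<nu> UC_b_const[of 0] unfolding mean_def by blast
  then have "\<nu> (\<lambda>x\<in>carrier G. 0) = 0" by simp
  then show ?case using UC_b_const[of 0] unfolding sum.empty by blast
next
  case (insert i I)
  let ?s = "\<lambda>x\<in>carrier G. \<Sum>i\<in>I. f i x"
  have "?s \<in> UC_b G T \<and> \<nu> ?s = (\<Sum>i\<in>I. \<nu> (f i))"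
    by (rule insert.IH) (use insert.prems in blast)
  then have s: "?s \<in> UC_b G T" "\<nu> ?s = (\<Sum>i\<in>I. \<nu> (f i))" by blast+
  have fi: "f i \<in> UC_b G T" using insert by auto
  have eq: "(\<lambda>x\<in>carrier G. f i x + ?s x) = (\<lambda>x\<in>carrier G. \<Sum>i\<in>insert i I. f i x)"
    using insert.hyps by (auto simp: restrict_def fun_eq_iff)
  have "\<nu> (\<lambda>x\<in>carrier G. f i x + ?s x) = \<nu> (f i) + \<nu> ?s"
    using \<nu> s(1) fi unfolding mean_def by blast
  moreover have "(\<lambda>x\<in>carrier G. f i x + ?s x) \<in> UC_b G T" by (rule UC_b_add[OF fi s(1)])
  moreover have "(\<Sum>i\<in>insert i I. \<nu> (f i)) = \<nu> (f i) + \<nu> ?s" using s(2) insert.hyps by simp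
  ultimately show ?case unfolding eq by metis
qed

lemma mean_upper:
  assumes "mean G T \<nu>" "f \<in> UC_b G T" "\<And>x. x \<in> carrier G \<Longrightarrow> f x \<le> b"
  shows "\<nu> f \<le> b"
proof -
  have "\<nu> f \<le> (SUP x\<in>carrier G. f x)" using assms by (auto simp: mean_def)
  also have "\<dots> \<le> b" using assms(3) by (intro cSUP_least) auto
  finally show ?thesis .
qed

lemma mean_lower:
  assumes "mean G T \<nu>" "f \<in> UC_b G T" "\<And>x. x \<in> carrier G \<Longrightarrow> b \<le> f x"
  shows "b \<le> \<nu> f"
proof -
  have "b \<le> (INF x\<in>carrier G. f x)" using assms(3) by (intro cINF_greatest) auto
  also have "\<dots> \<le> \<nu> f" using assms by (auto simp: mean_def)
  finally show ?thesis .
qed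

text \<open>The condition on \<open>S\<close> says that the sets \<open>s\<inverse>B\<close> are pairwise disjoint. A further translate \<open>t\<inverse>B\<close> meets an
  earlier one \<open>s\<inverse>B\<close> only if \<open>t\<close> lies in the finite set \<open>B B\<inverse> s\<close>.\<close>

lemma disjoint_translates:
  assumes inf: "infinite (carrier G)" and B: "finite B" "B \<subseteq> carrier G" "B \<noteq> {}"
  shows "\<exists>S. S \<subseteq> carrier G \<and> finite S \<and> card S = n \<and>
    (\<forall>s\<in>S. \<forall>t\<in>S. \<forall>x\<in>carrier G. s \<otimes> x \<in> B \<and> t \<otimes> x \<in> B \<longrightarrow> s = t)"
proof (induction n)
  case 0
  show ?case by (intro exI[of _ "{}"]) simp
next
  case (Suc n)
  then obtain S where S: "S \<subseteq> carrier G" "finite S" "card S = n"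
    "\<And>s t x. s \<in> S \<Longrightarrow> t \<in> S \<Longrightarrow> x \<in> carrier G \<Longrightarrow> s \<otimes> x \<in> B \<Longrightarrow> t \<otimes> x \<in> B \<Longrightarrow> s = t" by blast
  \<comment> \<open>The products \<open>b b'\<inverse> s\<close> that the next translation has to avoid.\<close>
  define bad where "bad = (\<lambda>(b, b', s). b \<otimes> inv b' \<otimes> s) ` (B \<times> B \<times> S)"
  have "finite bad" using B S by (simp add: bad_def)
  then obtain t where t: "t \<in> carrier G" "t \<notin> bad" using inf by (meson finite_subset subsetI)
  have sep: False if s: "s \<in> S" and x: "x \<in> carrier G" and sx: "s \<otimes> x \<in> B" and tx: "t \<otimes> x \<in> B" for s x
  proof -
    have sG: "s \<in> carrier G" using S s by auto
    have "(t \<otimes> x) \<otimes> inv (s \<otimes> x) \<otimes> s = t \<otimes> (x \<otimes> inv x) \<otimes> (inv s \<otimes> s)"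
      using t(1) x sG by (simp only: inv_mult_group m_assoc m_closed inv_closed)
    also have "\<dots> = t" using t(1) x sG by simp
    finally have "t \<in> bad" unfolding bad_def using s sx tx by force
    then show False using t(2) by simp
  qed
  obtain b where b: "b \<in> B" using B by blast
  have "t \<notin> S"
  proof
    assume "t \<in> S"
    moreover have "inv t \<otimes> b \<in> carrier G" "t \<otimes> (inv t \<otimes> b) = b"
      using t b B by (auto simp: m_assoc[symmetric] subset_iff)
    ultimately show False using sep[of t "inv t \<otimes> b"] b by simp
  qed
  then have "card (insert t S) = Suc n" using S by simp
  then show ?case
    using S t sep by (intro exI[of _ "insert t S"]) (auto; blast)
qed

text \<open>If \<open>B\<close> is nonempty, an infinite group contains arbitrarily many disjoint translates of \<open>B\<close>; they
  all have the same mass.\<close>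

lemma invariant_mean_finite_null:
  assumes \<nu>: "mean G T \<nu>"
    and inv: "\<And>f g. f \<in> UC_b G T \<Longrightarrow> g \<in> carrier G \<Longrightarrow> \<nu> (\<lambda>x\<in>carrier G. f (g \<otimes> x)) = \<nu> f"
    and inf: "infinite (carrier G)" and B: "finite B" "B \<subseteq> carrier G"
    and f: "(\<lambda>x\<in>carrier G. indicator B x) \<in> UC_b G T"
  shows "\<nu> (\<lambda>x\<in>carrier G. indicator B x) \<le> 0"
proof (cases "B = {}")
  case True
  then show ?thesis by (intro mean_upper[OF \<nu> f]) simp
next
  case False
  let ?f = "\<lambda>x\<in>carrier G. indicator B x :: real"
  show ?thesis
  proof (rule ccontr)
    assume "\<not> ?thesis"
    then obtain n where n: "real n * \<nu> ?f > 1" by (metis reals_Archimedean3 not_le)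
    obtain S where S: "S \<subseteq> carrier G" "finite S" "card S = n"
      "\<And>s t x. s \<in> S \<Longrightarrow> t \<in> S \<Longrightarrow> x \<in> carrier G \<Longrightarrow> s \<otimes> x \<in> B \<Longrightarrow> t \<otimes> x \<in> B \<Longrightarrow> s = t"
      using disjoint_translates[OF inf B False, of n] by metis
    let ?g = "\<lambda>s. \<lambda>x\<in>carrier G. ?f (s \<otimes> x)"
    have g: "?g s \<in> UC_b G T" if "s \<in> S" for s using UC_b_left_translate[OF f] that S(1) by blast
    have "real n * \<nu> ?f = (\<Sum>s\<in>S. \<nu> (?g s))"
      using inv[OF f] S by (simp add: subset_iff)
    also have "\<dots> = \<nu> (\<lambda>x\<in>carrier G. \<Sum>s\<in>S. ?g s x)"
      using mean_sum[OF \<nu> S(2) g] by simp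
    also have "\<dots> \<le> 1"
    proof (rule mean_upper[OF \<nu>])
      show "(\<lambda>x\<in>carrier G. \<Sum>s\<in>S. ?g s x) \<in> UC_b G T" using mean_sum[OF \<nu> S(2) g] by simp
      fix x assume x: "x \<in> carrier G"
      have "(\<Sum>s\<in>S. ?g s x) = (\<Sum>s\<in>S. indicator B (s \<otimes> x))"
        using x S(1) by (intro sum.cong) auto
      also have "\<dots> = real (card {s\<in>S. s \<otimes> x \<in> B})"
        using S(2) by (simp add: indicator_def sum.If_cases Int_def flip: of_bool_def)
      also have "card {s\<in>S. s \<otimes> x \<in> B} \<le> Suc 0"
        using S(2,4) x by (subst card_le_Suc0_iff_eq) auto
      finally show "(\<lambda>x\<in>carrier G. \<Sum>s\<in>S. ?g s x) x \<le> 1"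
        unfolding restrict_apply'[OF x] by simp
    qed
    finally show False using n by simp
  qed
qed

text \<open>For finite \<open>G\<close> take \<open>F = G\<close>. Otherwise colour \<open>x\<close> by the tuple \<open>c x\<close> of the \<open>\<phi>\<close>-colours of the cosets of
  \<open>g x\<close>, for \<open>g\<close> in \<open>E\<close> and \<open>g = 1\<close>. Functions of \<open>c\<close> are right uniformly continuous, so the invariant
  mean assigns a mass to every tuple, and tuples occurring only finitely often have mass \<open>0\<close>. Select
  \<open>F\<close> proportionally. The cardinalities of \<open>F\<close> and \<open>gF\<close> in a \<open>\<phi>\<close>-class are the numbers of points of \<open>F\<close>
  with a given entry of the tuple at \<open>1\<close> and at \<open>g\<close>, and these two events have the same mass by
  invariance.\<close>

lemma amenable_imp_folner_on_colourings:
  fixes \<phi> :: "'a set \<Rightarrow> 'k"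
  assumes am: "amenable G T" and H: "open_subgroup G T H"
    and \<phi>: "finite (\<phi> ` (rcosets H))" and E: "finite E" "E \<subseteq> carrier G" and e: "e > 0"
  obtains F where "F \<subseteq> carrier G" "finite F" "F \<noteq> {}"
    and "\<And>i g. g \<in> E \<Longrightarrow> \<bar>real (card (F \<inter> (\<phi> \<circ> coset_proj G H) -` {i}))
           - real (card ((g <# F) \<inter> (\<phi> \<circ> coset_proj G H) -` {i}))\<bar> \<le> e * real (card F)"
proof (cases "finite (carrier G)")
  case True
  have "g <# carrier G = carrier G" if "g \<in> E" for g
  proof
    have g: "g \<in> carrier G" using that E by auto
    then show "g <# carrier G \<subseteq> carrier G" by (auto simp: l_coset_def)
    show "carrier G \<subseteq> g <# carrier G"
    proof
      fix x assume x: "x \<in> carrier G"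
      then have "x = g \<otimes> (inv g \<otimes> x)" "inv g \<otimes> x \<in> carrier G" using g by (auto simp: m_assoc[symmetric])
      then show "x \<in> g <# carrier G" unfolding l_coset_def by blast
    qed
  qed
  then show ?thesis using True e by (intro that[of "carrier G"]) auto
next
  case inf: False
  have sub: "subgroup H G" and HG: "H \<subseteq> carrier G"
    using H by (auto simp: open_subgroup_def subgroup.subset)
  obtain \<nu> where \<nu>: "mean G T \<nu>"
    and "\<And>f g. f \<in> UC_b G T \<Longrightarrow> g \<in> carrier G \<Longrightarrow>
      \<nu> (restrict (f \<circ> left_transl G g) (carrier G)) = \<nu> f"
    using am unfolding amenable_def by blast
  then have inv: "\<nu> (\<lambda>x\<in>carrier G. f (g \<otimes> x)) = \<nu> f" if "f \<in> UC_b G T" "g \<in> carrier G" for f g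
    using that by (simp add: comp_def left_transl_def)
  define E1 where "E1 = insert \<one> E"
  have E1: "finite E1" "E1 \<subseteq> carrier G" using E by (auto simp: E1_def)
  define c where "c = (\<lambda>x. \<lambda>g\<in>E1. \<phi> (H #> (g \<otimes> x)))"
  have colour: "c x g = \<phi> (H #> (g \<otimes> x))" if "g \<in> E1" for x g using that by (simp add: c_def)
  define J where "J = c ` carrier G"
  have J: "finite J"
  proof (rule finite_subset)
    show "J \<subseteq> E1 \<rightarrow>\<^sub>E \<phi> ` (rcosets H)"
      using E1(2) rcosetsI[OF HG] by (auto simp: J_def c_def subset_iff)
    show "finite (E1 \<rightarrow>\<^sub>E \<phi> ` (rcosets H))" using E1(1) \<phi> by (rule finite_PiE)
  qed
  have nbhd: "one_nbhd G T H"
    using H sub subgroup.one_closed HG topspace_eq_carrier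
    by (auto simp: one_nbhd_def open_subgroup_def)
  have c_uc: "(\<lambda>x\<in>carrier G. of_bool (P (c x)) :: real) \<in> UC_b G T" for P
  proof (rule UC_bI[of _ 1])
    fix \<epsilon> :: real assume "\<epsilon> > 0"
    let ?U = "{u \<in> carrier G. \<forall>g\<in>E1. g \<otimes> u \<otimes> inv g \<in> H}"
    have "c x = c y" if xy: "x \<in> carrier G" "y \<in> carrier G" "x \<otimes> inv y \<in> ?U" for x y
    proof -
      have "H #> (g \<otimes> x) = H #> (g \<otimes> y)" if "g \<in> E1" for g
      proof -
        have g: "g \<in> carrier G" using that E1 by auto
        have h: "g \<otimes> (x \<otimes> inv y) \<otimes> inv g \<in> H" (is "?h \<in> H") using xy that by auto
        have "g \<otimes> x = ?h \<otimes> (g \<otimes> y)"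
        proof -
          have "?h \<otimes> (g \<otimes> y) = g \<otimes> x \<otimes> inv y \<otimes> (inv g \<otimes> g) \<otimes> y"
            using g xy(1,2) by (simp only: m_assoc m_closed inv_closed)
          also have "\<dots> = g \<otimes> x" using g xy(1,2) by (simp add: m_assoc)
          finally show ?thesis by simp
        qed
        then have "H #> (g \<otimes> x) = (H #> ?h) #> (g \<otimes> y)"
          using g xy(1,2) HG by (simp add: coset_mult_assoc)
        also have "H #> ?h = H" using h HG sub by (intro coset_join2) auto
        finally show ?thesis .
      qed
      then show ?thesis by (auto simp: c_def)
    qed
    then have "\<forall>x\<in>carrier G. \<forall>y\<in>carrier G. x \<otimes> inv y \<in> ?U \<longrightarrow>
        \<bar>of_bool (P (c x)) - of_bool (P (c y)) :: real\<bar> \<le> \<epsilon>" using \<open>\<epsilon> > 0\<close> by auto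
    then show "\<exists>U. one_nbhd G T U \<and> (\<forall>x\<in>carrier G. \<forall>y\<in>carrier G. x \<otimes> inv y \<in> U \<longrightarrow>
        \<bar>of_bool (P (c x)) - of_bool (P (c y)) :: real\<bar> \<le> \<epsilon>)"
      using one_nbhd_conjugates[OF nbhd E1] by blast
  qed simp
  define p where "p = (\<lambda>j. \<nu> (\<lambda>x\<in>carrier G. of_bool (c x = j)))"
  have p_sum: "(\<Sum>j\<in>{j\<in>J. P j}. p j) = \<nu> (\<lambda>x\<in>carrier G. of_bool (P (c x)))" for P
  proof -
    let ?f = "\<lambda>j. \<lambda>x\<in>carrier G. of_bool (c x = j) :: real"
    have "(\<Sum>j\<in>{j\<in>J. P j}. p j) = \<nu> (\<lambda>x\<in>carrier G. \<Sum>j\<in>{j\<in>J. P j}. ?f j x)"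
      unfolding p_def by (rule conjunct2[OF mean_sum[OF \<nu>], symmetric]) (use J c_uc in auto)
    also have "(\<lambda>x\<in>carrier G. \<Sum>j\<in>{j\<in>J. P j}. ?f j x) = (\<lambda>x\<in>carrier G. of_bool (P (c x)))"
    proof (rule restrict_ext)
      fix x assume x: "x \<in> carrier G"
      have "(\<Sum>j\<in>{j\<in>J. P j}. ?f j x) = (\<Sum>j\<in>{j\<in>J. P j}. if c x = j then 1 else 0)"
        using x by (intro sum.cong) auto
      also have "\<dots> = of_bool (P (c x))" using J x by (auto simp: J_def sum.delta')
      finally show "(\<Sum>j\<in>{j\<in>J. P j}. ?f j x) = of_bool (P (c x))" .
    qed
    finally show ?thesis .
  qed
  obtain F where F: "F \<subseteq> carrier G" "finite F" "F \<noteq> {}" "c ` F \<subseteq> J"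
    and dev: "\<And>I. I \<subseteq> J \<Longrightarrow>
      \<bar>real (card {x\<in>F. c x \<in> I}) - real (card F) * (\<Sum>j\<in>I. p j)\<bar> \<le> e / 2 * real (card F)"
  proof (rule proportional_selection[of J p "carrier G" c "e / 2"])
    show "p j \<ge> 0" for j
      unfolding p_def by (intro mean_lower[OF \<nu> c_uc]) simp
    have "(\<Sum>j\<in>J. p j) = \<nu> (\<lambda>x\<in>carrier G. of_bool True)" using p_sum[of "\<lambda>_. True"] by simp
    also have "\<dots> = 1"
      by (intro order_antisym mean_upper[OF \<nu> c_uc] mean_lower[OF \<nu> c_uc]) auto
    finally show "(\<Sum>j\<in>J. p j) = 1" .
    show "infinite {x \<in> carrier G. c x = j}" if "j \<in> J" "p j > 0" for j
    proof
      assume fin: "finite {x \<in> carrier G. c x = j}"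
      let ?B = "{x \<in> carrier G. c x = j}"
      have eq: "(\<lambda>x\<in>carrier G. indicator ?B x :: real) = (\<lambda>x\<in>carrier G. of_bool (c x = j))"
        by (rule restrict_ext) (simp add: indicator_def)
      have "\<nu> (\<lambda>x\<in>carrier G. indicator ?B x) \<le> 0"
        by (rule invariant_mean_finite_null[OF \<nu> inv inf fin]) (use c_uc in \<open>auto simp: eq\<close>)
      then show False using that(2) by (simp add: eq p_def)
    qed
  qed (use J e in auto)
  show ?thesis
  proof (rule that[OF F(1-3)])
    fix i g assume gE: "g \<in> E"
    then have g: "g \<in> carrier G" "g \<in> E1" using E by (auto simp: E1_def)
    have one: "\<one> \<in> E1" by (simp add: E1_def)
    let ?A = "(\<phi> \<circ> coset_proj G H) -` {i}"
    let ?I = "\<lambda>g. {j\<in>J. j g = i}"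
    have cJ: "c x \<in> J" if "x \<in> F" for x using F(4) that by blast
    have col1: "c x \<one> = \<phi> (H #> x)" if "x \<in> F" for x
      using F(1) that by (simp add: colour[OF one] subset_iff)
    have "F \<inter> ?A = {x\<in>F. c x \<in> ?I \<one>}"
      by (rule Set.set_eqI) (use cJ col1 in \<open>auto simp: coset_proj_def\<close>)
    then have 1: "\<bar>real (card (F \<inter> ?A)) - real (card F) * (\<Sum>j\<in>?I \<one>. p j)\<bar> \<le> e / 2 * real (card F)"
      using dev[of "?I \<one>"] by simp
    have mem: "g \<otimes> x \<in> ?A \<longleftrightarrow> c x \<in> ?I g" if "x \<in> F" for x
      using cJ[OF that] by (simp add: colour[OF g(2)] coset_proj_def)
    have "card ((g <# F) \<inter> ?A) = card {x\<in>F. g \<otimes> x \<in> ?A}"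
      by (rule card_left_translate_Int[OF F(1) g(1)])
    also have "{x\<in>F. g \<otimes> x \<in> ?A} = {x\<in>F. c x \<in> ?I g}" using mem by (intro Collect_cong conj_cong refl)
    finally have "card ((g <# F) \<inter> ?A) = card {x\<in>F. c x \<in> ?I g}" .
    then have 2: "\<bar>real (card ((g <# F) \<inter> ?A)) - real (card F) * (\<Sum>j\<in>?I g. p j)\<bar> \<le> e / 2 * real (card F)"
      using dev[of "?I g"] by simp
    let ?f = "\<lambda>x\<in>carrier G. of_bool (c x \<one> = i) :: real"
    have "(\<Sum>j\<in>?I g. p j) = \<nu> (\<lambda>x\<in>carrier G. of_bool (c x g = i))" by (rule p_sum)
    also have "(\<lambda>x\<in>carrier G. of_bool (c x g = i)) = (\<lambda>x\<in>carrier G. ?f (g \<otimes> x))"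
      using g by (intro restrict_ext) (simp add: colour[OF one] colour[OF g(2)])
    also have "\<nu> \<dots> = \<nu> ?f" by (rule inv[OF c_uc g(1)])
    also have "\<dots> = (\<Sum>j\<in>?I \<one>. p j)" by (rule p_sum[symmetric])
    finally have eq: "(\<Sum>j\<in>?I g. p j) = (\<Sum>j\<in>?I \<one>. p j)" .
    have close: "\<bar>a - b\<bar> \<le> d" if "\<bar>a - s\<bar> \<le> d / 2" "\<bar>b - s\<bar> \<le> d / 2" for a b s d :: real
      using that by linarith
    show "\<bar>real (card (F \<inter> ?A)) - real (card ((g <# F) \<inter> ?A))\<bar> \<le> e * real (card F)"
      by (rule close[OF 1[unfolded times_divide_eq_left] 2[unfolded eq times_divide_eq_left]])
  qed
qed

end

context group
begin

text \<open>A set of the form \<open>HA\<close> is a union of right cosets, hence a class of a colouring with two colours.\<close>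

lemma folner_on_colourings_imp_folner_on_sets:
  assumes H: "subgroup H G"
    and col: "\<And>\<epsilon> \<phi> E. \<epsilon> > 0 \<Longrightarrow> \<phi> \<in> rcosets H \<rightarrow> {0..1::nat} \<Longrightarrow> E \<subseteq> carrier G \<Longrightarrow> finite E \<Longrightarrow>
      \<exists>F. F \<subseteq> carrier G \<and> finite F \<and> F \<noteq> {} \<and> (\<forall>i\<in>{0..1}. \<forall>g\<in>E.
        \<bar>real (card (F \<inter> (\<phi> \<circ> coset_proj G H) -` {i}))
          - real (card ((g <# F) \<inter> (\<phi> \<circ> coset_proj G H) -` {i}))\<bar> \<le> \<epsilon> * real (card F))"
  shows "folner_on_sets H"
  unfolding folner_on_sets_def
proof (intro allI impI)
  fix \<epsilon> :: real and A E
  assume e: "\<epsilon> > 0" and A: "A \<subseteq> carrier G" and E: "E \<subseteq> carrier G \<and> finite E"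
  have HG: "H \<subseteq> carrier G" using H by (rule subgroup.subset)
  define \<phi> where "\<phi> = (\<lambda>C. if C \<subseteq> H <#> A then 1 else 0 :: nat)"
  have coset: "H #> x \<subseteq> H <#> A \<longleftrightarrow> x \<in> H <#> A" if x: "x \<in> carrier G" for x
  proof
    show "x \<in> H <#> A" if "H #> x \<subseteq> H <#> A" using that rcos_self[OF x H] by blast
    assume "x \<in> H <#> A"
    then obtain h a where ha: "h \<in> H" "a \<in> A" "x = h \<otimes> a" by (auto simp: set_mult_def)
    show "H #> x \<subseteq> H <#> A"
    proof
      fix y assume "y \<in> H #> x"
      then obtain h' where h': "h' \<in> H" "y = h' \<otimes> x" by (auto simp: r_coset_def)
      then have "y = (h' \<otimes> h) \<otimes> a" using ha A HG by (auto simp: m_assoc subset_iff)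
      moreover have "h' \<otimes> h \<in> H" using H h'(1) ha(1) by (rule subgroup.m_closed)
      ultimately show "y \<in> H <#> A" using ha(2) by (auto simp: set_mult_def)
    qed
  qed
  have level: "F \<inter> (\<phi> \<circ> coset_proj G H) -` {1} = F \<inter> (H <#> A)" if "F \<subseteq> carrier G" for F
    using that coset by (auto simp: \<phi>_def coset_proj_def subset_iff[of F] split: if_splits)
  have "\<phi> \<in> rcosets H \<rightarrow> {0..1}" by (auto simp: \<phi>_def)
  from col[OF e this conjunct1[OF E] conjunct2[OF E]] obtain F
    where F: "F \<subseteq> carrier G" "finite F" "F \<noteq> {}"
      and fol: "\<forall>i\<in>{0..1}. \<forall>g\<in>E. \<bar>real (card (F \<inter> (\<phi> \<circ> coset_proj G H) -` {i}))
          - real (card ((g <# F) \<inter> (\<phi> \<circ> coset_proj G H) -` {i}))\<bar> \<le> \<epsilon> * real (card F)"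
    by (elim exE conjE) rule
  have "\<bar>real (card (F \<inter> (H <#> A))) - real (card ((g <# F) \<inter> (H <#> A)))\<bar> \<le> \<epsilon> * real (card F)"
    if g: "g \<in> E" for g
  proof -
    have "g <# F \<subseteq> carrier G" using F(1) g E by (auto simp: l_coset_def)
    moreover have "1 \<in> {0..1::nat}" by simp
    from fol[rule_format, OF this g]
    have "\<bar>real (card (F \<inter> (\<phi> \<circ> coset_proj G H) -` {1}))
        - real (card ((g <# F) \<inter> (\<phi> \<circ> coset_proj G H) -` {1}))\<bar> \<le> \<epsilon> * real (card F)" .
    ultimately show ?thesis using level[OF F(1)] level[of "g <# F"] by simp
  qed
  then show "\<exists>F. F \<subseteq> carrier G \<and> finite F \<and> F \<noteq> {} \<and> (\<forall>g\<in>E.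
      \<bar>real (card (F \<inter> (H <#> A))) - real (card ((g <# F) \<inter> (H <#> A)))\<bar> \<le> \<epsilon> * real (card F))"
    using F by blast
qed

end

section \<open>The equivalence\<close>

theorem corollary7p1:
  fixes G :: "('a, 'b) monoid_scheme" (structure)
    and T :: "'a topology"
  assumes "topological_group G T"
    and "Hausdorff_space T"
    and "non_archimedean G T"
  shows
    "(amenable G T \<longleftrightarrow>
       (\<forall>\<epsilon>>0::real. \<forall>H. open_subgroup G T H \<longrightarrow>
         (\<forall>n::nat. n \<ge> 1 \<longrightarrow> (\<forall>\<phi> \<in> rcosets H \<rightarrow> {0..n}.
           \<forall>E. E \<subseteq> carrier G \<and> finite E \<longrightarrow>
             (\<exists>F. F \<subseteq> carrier G \<and> finite F \<and> F \<noteq> {} \<and>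
               (\<forall>i\<in>{0..n}. \<forall>g\<in>E.
                 \<bar>real (card (F \<inter> (\<phi> \<circ> coset_proj G H) -` {i}))
                   - real (card ((g <# F) \<inter> (\<phi> \<circ> coset_proj G H) -` {i}))\<bar>
                 \<le> \<epsilon> * real (card F)))))))
     \<and>
     (amenable G T \<longleftrightarrow>
       (\<forall>\<epsilon>>0::real. \<forall>H. open_subgroup G T H \<longrightarrow>
         (\<forall>A. A \<subseteq> carrier G \<longrightarrow>
           (\<forall>E. E \<subseteq> carrier G \<and> finite E \<longrightarrow>
             (\<exists>F. F \<subseteq> carrier G \<and> finite F \<and> F \<noteq> {} \<and>
               (\<forall>g\<in>E.
                 \<bar>real (card (F \<inter> (H <#> A))) - real (card ((g <# F) \<inter> (H <#> A)))\<bar>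
                 \<le> \<epsilon> * real (card F)))))))"
    (is "(_ \<longleftrightarrow> ?colourings) \<and> (_ \<longleftrightarrow> ?sets)")
proof -
  interpret topological_group G T by fact
  have "?colourings" if am: "amenable G T"
  proof (intro allI impI ballI)
    fix \<epsilon> :: real and H n \<phi> E
    assume *: "\<epsilon> > 0" "open_subgroup G T H" "\<phi> \<in> rcosets H \<rightarrow> {0..n::nat}" "E \<subseteq> carrier G \<and> finite E"
    have "finite (\<phi> ` (rcosets H))" using *(3) by (auto intro: finite_subset[of _ "{0..n}"])
    then obtain F where F: "F \<subseteq> carrier G" "finite F" "F \<noteq> {}"
      and fol: "\<And>i g. g \<in> E \<Longrightarrow> \<bar>real (card (F \<inter> (\<phi> \<circ> coset_proj G H) -` {i}))
           - real (card ((g <# F) \<inter> (\<phi> \<circ> coset_proj G H) -` {i}))\<bar> \<le> \<epsilon> * real (card F)"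
      by (rule amenable_imp_folner_on_colourings[OF am *(2) _ conjunct2[OF *(4)] conjunct1[OF *(4)] *(1)]) (rule that)
    show "\<exists>F. F \<subseteq> carrier G \<and> finite F \<and> F \<noteq> {} \<and> (\<forall>i\<in>{0..n}. \<forall>g\<in>E.
        \<bar>real (card (F \<inter> (\<phi> \<circ> coset_proj G H) -` {i}))
          - real (card ((g <# F) \<inter> (\<phi> \<circ> coset_proj G H) -` {i}))\<bar> \<le> \<epsilon> * real (card F))"
      by (intro exI[of _ F] conjI ballI F fol)
  qed
  moreover have sets: "?sets \<longleftrightarrow> (\<forall>H. open_subgroup G T H \<longrightarrow> folner_on_sets H)"
  proof -
    have swap: "(\<forall>\<epsilon>>0::real. \<forall>H. P H \<longrightarrow> Q \<epsilon> H) \<longleftrightarrow> (\<forall>H. P H \<longrightarrow> (\<forall>\<epsilon>>0. Q \<epsilon> H))"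
      for P :: "'a set \<Rightarrow> bool" and Q by blast
    show ?thesis unfolding folner_on_sets_def by (rule swap)
  qed
  moreover have "?sets" if col: "?colourings"
    unfolding sets
  proof (intro allI impI)
    fix H assume H: "open_subgroup G T H"
    show "folner_on_sets H"
    proof (rule folner_on_colourings_imp_folner_on_sets)
      show "subgroup H G" using H by (simp add: open_subgroup_def)
      fix \<epsilon> :: real and \<phi> E
      assume "\<epsilon> > 0" "\<phi> \<in> rcosets H \<rightarrow> {0..1::nat}" "E \<subseteq> carrier G" "finite E"
      then show "\<exists>F. F \<subseteq> carrier G \<and> finite F \<and> F \<noteq> {} \<and> (\<forall>i\<in>{0..1}. \<forall>g\<in>E.
        \<bar>real (card (F \<inter> (\<phi> \<circ> coset_proj G H) -` {i}))
          - real (card ((g <# F) \<inter> (\<phi> \<circ> coset_proj G H) -` {i}))\<bar> \<le> \<epsilon> * real (card F))"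
        using col[rule_format, OF _ H, of \<epsilon> 1 \<phi> E] by simp
    qed
  qed
  moreover have "amenable G T" if "?sets"
    using folner_imp_amenable[OF assms(3)] that unfolding sets by blast
  ultimately show ?thesis by argo
qed

end
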